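(* For every even integer $k\ge 4$ and every integer $\ell\ge 2$ there is a constant $C=C(k,\ell)$ such that for all sufficiently large $n$, $$\mathrm{ex}(n,T_{k,\ell})\le C\, n^{\frac32+\frac{\ell}{k}}(\log n)^2.$$
   Context: $\mathrm{ex}(n,F)$ is the maximum number of edges in an $n$-vertex graph with no subgraph isomorphic to $F$; $\log$ is base 2. For even $k\ge 4$ and $\ell\ge 2$, the quadrangulated torus $T_{k,\ell}$ has vertex set $\{x_{i,j}:1\le i\le k,\ 1\le j\le \ell\}$ (all distinct) and edge set $\{x_{i,j}x_{i+1,j}:1\le i\le k,\ 1\le j\le\ell\}\cup\{x_{i,j+1}x_{i+1,j}:1\le i\le k,\ 1\le j\le \ell,\ i\text{ odd}\}\cup\{x_{i,j}x_{i+1,j+1}:1\le i\le k,\ 1\le j\le\ell,\ i\text{ even}\}$, where both coordinates are cyclic: $x_{k+1,j}=x_{1,j}$ for all $j$ and $x_{i,\ell+1}=x_{i,1}$ for all $i$. *)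

theory Defs
  imports Complex_Main
begin

definition simple_graph :: "'a set \<Rightarrow> 'a set set \<Rightarrow> bool" where
  "simple_graph V E \<longleftrightarrow> (\<forall>e\<in>E. e \<subseteq> V \<and> card e = 2)"

definition contains_copy :: "'a set \<Rightarrow> 'a set set \<Rightarrow> 'b set \<Rightarrow> 'b set set \<Rightarrow> bool" where
  "contains_copy V E VF EF \<longleftrightarrow>
     (\<exists>f. inj_on f VF \<and> f ` VF \<subseteq> V \<and> (\<forall>e\<in>EF. f ` e \<in> E))"

definition ex :: "nat \<Rightarrow> 'b set \<Rightarrow> 'b set set \<Rightarrow> nat" where
  "ex n VF EF = Max {card E | E. simple_graph {0..<n} E \<and> \<not> contains_copy {0..<n} E VF EF}"

text \<open>Cyclic successor on {1..m}: m goes to 1, otherwise x goes to x+1.\<close>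

definition cyc :: "nat \<Rightarrow> nat \<Rightarrow> nat" where
  "cyc m x = x mod m + 1"

definition torus_V :: "nat \<Rightarrow> nat \<Rightarrow> (nat \<times> nat) set" where
  "torus_V k l = {1..k} \<times> {1..l}"

definition torus_E :: "nat \<Rightarrow> nat \<Rightarrow> (nat \<times> nat) set set" where
  "torus_E k l =
     {{(i, j), (cyc k i, j)} | i j. i \<in> {1..k} \<and> j \<in> {1..l}}
   \<union> {{(i, cyc l j), (cyc k i, j)} | i j. i \<in> {1..k} \<and> j \<in> {1..l} \<and> odd i}
   \<union> {{(i, j), (cyc k i, cyc l j)} | i j. i \<in> {1..k} \<and> j \<in> {1..l} \<and> even i}"

end

theory Submission
  imports Defs "HOL-Library.FuncSet" "HOL-Analysis.Convex"
begin

text \<open>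
  Pass to a subgraph of minimum degree \<open>\<delta>\<close>, and call two \<open>l\<close>-tuples of vertices adjacent if together
  they form a closed \<open>2l\<close>-walk; with the right indexing this relation is symmetric, and a copy of the
  torus is a closed \<open>k\<close>-walk of tuples in which all coordinates of all tuples are distinct.
  Weight an adjacent pair of tuples by the product of \<open>1/deg\<close> over its \<open>2l\<close> vertices. The total weight is
  the trace of the \<open>2l\<close>-th power of the random walk on the graph, hence at least 1. Prescribing one
  coordinate of a neighbouring tuple opens the closed walk and costs a factor of order \<open>n/\<delta>\<^sup>2\<close>,
  so after deleting the tuples that violate this locally, the random walk on the remaining tuples
  hits any prescribed coordinate with probability at most \<open>\<eta>\<close>, a constant times \<open>n/\<delta>\<^sup>2\<close>.

  Let \<open>a\<^sub>q\<close> be the trace of the \<open>2q\<close>-th power of that walk and \<open>k = 2m\<close>. Cutting a closed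
  \<open>2m\<close>-walk at the step into a coinciding tuple and at the antipodal vertex, Cauchy--Schwarz bounds the
  weight of the closed walks with a given coincidence by \<open>sqrt (\<eta> a\<^sub>m a\<^sub>m\<^sub>-\<^sub>1)\<close>. Since \<open>a\<close> is
  log-convex with \<open>a\<^sub>m \<ge> 1\<close> and \<open>a\<^sub>0 \<le> n\<^sup>l\<close>, this is less than \<open>a\<^sub>m\<close> as soon as \<open>\<eta>\<close> is small
  compared with \<open>n\<close> to the power \<open>-2l/k\<close>. No logarithmic factor is lost.
\<close>

section \<open>Walk sums\<close>

text \<open>The (x, y) entry of the n-th power of the matrix \<open>P\<close> indexed by
  \<open>S\<close>; for a stochastic \<open>P\<close> it is the n-step transition
  probability.\<close>

primrec kpow :: "'a set \<Rightarrow> ('a \<Rightarrow> 'a \<Rightarrow> real) \<Rightarrow> nat \<Rightarrow> 'a \<Rightarrow> 'a \<Rightarrow> real" where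
  "kpow S P 0 x y = (if x = y then 1 else 0)"
| "kpow S P (Suc n) x y = (\<Sum>z\<in>S. P x z * kpow S P n z y)"

lemma kpow_add:
  assumes "finite S" "x \<in> S"
  shows "kpow S P (m + n) x y = (\<Sum>z\<in>S. kpow S P m x z * kpow S P n z y)"
  using assms(2)
proof (induction m arbitrary: x)
  case 0
  have "(\<Sum>z\<in>S. kpow S P 0 x z * kpow S P n z y) = (\<Sum>z\<in>S. if x = z then kpow S P n z y else 0)"
    by (intro sum.cong) auto
  then show ?case using 0 assms(1) by simp
next
  case (Suc m)
  have "kpow S P (Suc m + n) x y = (\<Sum>w\<in>S. \<Sum>z\<in>S. P x w * (kpow S P m w z * kpow S P n z y))"
    using Suc by (simp add: sum_distrib_left)
  also have "\<dots> = (\<Sum>z\<in>S. \<Sum>w\<in>S. P x w * (kpow S P m w z * kpow S P n z y))"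
    by (rule sum.swap)
  finally show ?case by (simp add: sum_distrib_right mult.assoc)
qed

lemma kpow_1:
  assumes "finite S" "y \<in> S"
  shows "kpow S P (Suc 0) x y = P x y"
proof -
  have "kpow S P (Suc 0) x y = (\<Sum>z\<in>S. if z = y then P x z else 0)"
    by (auto intro!: sum.cong)
  then show ?thesis using assms by simp
qed

lemma kpow_Suc_right:
  assumes "finite S" "x \<in> S" "y \<in> S"
  shows "kpow S P (Suc n) x y = (\<Sum>z\<in>S. kpow S P n x z * P z y)"
  using kpow_add[OF assms(1,2), of P n "Suc 0" y] kpow_1[OF assms(1,3)] by simp

lemma kpow_nonneg:
  assumes "\<And>x y. x \<in> S \<Longrightarrow> y \<in> S \<Longrightarrow> P x y \<ge> 0" "x \<in> S"
  shows "kpow S P n x y \<ge> 0"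
  using assms(2) by (induction n arbitrary: x) (auto intro!: sum_nonneg mult_nonneg_nonneg assms(1))

text \<open>
  The weighted sum of \<open>F\<close> over all walks with \<open>n\<close> steps from \<open>x\<close>, where a walk is the list of its
  \<open>n + 1\<close> vertices.
\<close>

primrec wsum :: "'a set \<Rightarrow> ('a \<Rightarrow> 'a \<Rightarrow> real) \<Rightarrow> nat \<Rightarrow> 'a \<Rightarrow> ('a list \<Rightarrow> real) \<Rightarrow> real" where
  "wsum S P 0 x F = F [x]"
| "wsum S P (Suc n) x F = (\<Sum>z\<in>S. P x z * wsum S P n z (\<lambda>w. F (x # w)))"

text \<open>A step of weight zero kills both sides, so the comparison is needed only along walks all
  of whose steps have positive weight. This is how a walk extracted later comes with genuine
  edges.\<close>

lemma wsum_mono: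
  assumes "\<And>x y. x \<in> S \<Longrightarrow> y \<in> S \<Longrightarrow> P x y \<ge> 0" and "x \<in> S"
    and "\<And>w. \<lbrakk>length w = Suc n; w ! 0 = x; set w \<subseteq> S; \<forall>i<n. P (w ! i) (w ! Suc i) > 0\<rbrakk> \<Longrightarrow> F w \<le> G w"
  shows "wsum S P n x F \<le> wsum S P n x G"
  using assms(2,3)
proof (induction n arbitrary: x F G)
  case 0
  then show ?case by auto
next
  case (Suc n)
  have "P x z * wsum S P n z (\<lambda>w. F (x # w)) \<le> P x z * wsum S P n z (\<lambda>w. G (x # w))"
    if z: "z \<in> S" for z
  proof (cases "P x z = 0")
    case False
    then have pos: "P x z > 0" using assms(1)[OF \<open>x \<in> S\<close> z] by simp
    have "wsum S P n z (\<lambda>w. F (x # w)) \<le> wsum S P n z (\<lambda>w. G (x # w))"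
    proof (rule Suc.IH[OF z])
      fix w assume w: "length w = Suc n" "w ! 0 = z" "set w \<subseteq> S" "\<forall>i<n. P (w ! i) (w ! Suc i) > 0"
      have "P ((x # w) ! i) ((x # w) ! Suc i) > 0" if "i < Suc n" for i
        using that w pos by (cases i) auto
      then show "F (x # w) \<le> G (x # w)"
        using w Suc.prems(1) by (intro Suc.prems(2)) auto
    qed
    then show ?thesis using pos by simp
  qed simp
  then show ?case by (auto intro: sum_mono)
qed

lemma wsum_sum: "wsum S P n x (\<lambda>w. \<Sum>i\<in>J. F i w) = (\<Sum>i\<in>J. wsum S P n x (F i))"
proof (induction n arbitrary: x F)
  case (Suc n)
  have "wsum S P (Suc n) x (\<lambda>w. \<Sum>i\<in>J. F i w) = (\<Sum>z\<in>S. \<Sum>i\<in>J. P x z * wsum S P n z (\<lambda>w. F i (x # w)))"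
    by (simp add: Suc sum_distrib_left)
  also have "\<dots> = (\<Sum>i\<in>J. \<Sum>z\<in>S. P x z * wsum S P n z (\<lambda>w. F i (x # w)))"
    by (rule sum.swap)
  finally show ?case by simp
qed simp

lemma wsum_last:
  assumes "finite S" "x \<in> S"
  shows "wsum S P n x (\<lambda>w. g (w ! n)) = (\<Sum>z\<in>S. kpow S P n x z * g z)"
  using assms(2)
proof (induction n arbitrary: x)
  case 0
  have "(\<Sum>z\<in>S. kpow S P 0 x z * g z) = (\<Sum>z\<in>S. if x = z then g z else 0)"
    by (intro sum.cong) auto
  then show ?case using 0 assms(1) by simp
next
  case (Suc n)
  have "wsum S P (Suc n) x (\<lambda>w. g (w ! Suc n)) = (\<Sum>y\<in>S. \<Sum>z\<in>S. P x y * (kpow S P n y z * g z))"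
    by (simp add: Suc sum_distrib_left)
  also have "\<dots> = (\<Sum>z\<in>S. \<Sum>y\<in>S. P x y * (kpow S P n y z * g z))"
    by (rule sum.swap)
  finally show ?case by (simp add: sum_distrib_right mult.assoc)
qed

lemma wsum_two:
  assumes "finite S" "x \<in> S" "j \<le> n"
  shows "wsum S P n x (\<lambda>w. g (w ! j) (w ! n))
    = (\<Sum>y\<in>S. kpow S P j x y * (\<Sum>z\<in>S. kpow S P (n - j) y z * g y z))"
  using assms(2,3)
proof (induction j arbitrary: n x)
  case 0
  have "wsum S P n x (\<lambda>w. g (w ! 0) (w ! n)) = wsum S P n x (\<lambda>w. g x (w ! n))"
    by (cases n) auto
  also have "\<dots> = (\<Sum>z\<in>S. kpow S P n x z * g x z)"
    using wsum_last[OF assms(1) 0(1), of P n "g x"] by simp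
  also have "\<dots> = (\<Sum>y\<in>S. if x = y then \<Sum>z\<in>S. kpow S P n y z * g y z else 0)"
    using 0 assms(1) by simp
  also have "\<dots> = (\<Sum>y\<in>S. kpow S P 0 x y * (\<Sum>z\<in>S. kpow S P (n - 0) y z * g y z))"
    by (intro sum.cong) auto
  finally show ?case .
next
  case (Suc j)
  then obtain n' where n: "n = Suc n'" by (cases n) auto
  have "wsum S P n x (\<lambda>w. g (w ! Suc j) (w ! n))
     = (\<Sum>u\<in>S. P x u * (\<Sum>y\<in>S. kpow S P j u y * (\<Sum>z\<in>S. kpow S P (n' - j) y z * g y z)))"
    using Suc.prems n by (auto intro!: sum.cong simp: Suc.IH)
  also have "\<dots> = (\<Sum>u\<in>S. \<Sum>y\<in>S. P x u * kpow S P j u y * (\<Sum>z\<in>S. kpow S P (n' - j) y z * g y z))"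
    by (simp add: sum_distrib_left mult.assoc)
  also have "\<dots> = (\<Sum>y\<in>S. \<Sum>u\<in>S. P x u * kpow S P j u y * (\<Sum>z\<in>S. kpow S P (n' - j) y z * g y z))"
    by (rule sum.swap)
  finally show ?case using n by (simp add: sum_distrib_right)
qed

lemma wsum_three:
  assumes "finite S" "x \<in> S" "i \<le> j" "j \<le> n"
  shows "wsum S P n x (\<lambda>w. g (w ! i) (w ! j) (w ! n))
    = (\<Sum>y\<in>S. kpow S P i x y * (\<Sum>y'\<in>S. kpow S P (j - i) y y' * (\<Sum>z\<in>S. kpow S P (n - j) y' z * g y y' z)))"
  using assms(2-)
proof (induction i arbitrary: j n x)
  case 0
  have "wsum S P n x (\<lambda>w. g (w ! 0) (w ! j) (w ! n)) = wsum S P n x (\<lambda>w. g x (w ! j) (w ! n))"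
    by (cases n) auto
  also have "\<dots> = (\<Sum>y'\<in>S. kpow S P j x y' * (\<Sum>z\<in>S. kpow S P (n - j) y' z * g x y' z))"
    using wsum_two[OF assms(1) 0(1,3), of P "g x"] by simp
  also have "\<dots> = (\<Sum>y\<in>S. if x = y then \<Sum>y'\<in>S. kpow S P j y y' * (\<Sum>z\<in>S. kpow S P (n - j) y' z * g y y' z) else 0)"
    using 0 assms(1) by simp
  also have "\<dots> = (\<Sum>y\<in>S. kpow S P 0 x y * (\<Sum>y'\<in>S. kpow S P (j - 0) y y' * (\<Sum>z\<in>S. kpow S P (n - j) y' z * g y y' z)))"
    by (intro sum.cong) auto
  finally show ?case .
next
  case (Suc i)
  then obtain n' j' where n: "n = Suc n'" "j = Suc j'" by (cases n; cases j) auto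
  have "wsum S P n x (\<lambda>w. g (w ! Suc i) (w ! j) (w ! n))
     = (\<Sum>u\<in>S. P x u * (\<Sum>y\<in>S. kpow S P i u y * (\<Sum>y'\<in>S. kpow S P (j' - i) y y' * (\<Sum>z\<in>S. kpow S P (n' - j') y' z * g y y' z))))"
    using Suc.prems n by (auto intro!: sum.cong simp: Suc.IH)
  also have "\<dots> = (\<Sum>u\<in>S. \<Sum>y\<in>S. P x u * kpow S P i u y * (\<Sum>y'\<in>S. kpow S P (j' - i) y y' * (\<Sum>z\<in>S. kpow S P (n' - j') y' z * g y y' z)))"
    by (simp add: sum_distrib_left mult.assoc)
  also have "\<dots> = (\<Sum>y\<in>S. \<Sum>u\<in>S. P x u * kpow S P i u y * (\<Sum>y'\<in>S. kpow S P (j' - i) y y' * (\<Sum>z\<in>S. kpow S P (n' - j') y' z * g y y' z)))"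
    by (rule sum.swap)
  finally show ?case using n by (simp add: sum_distrib_right)
qed

text \<open>Cutting the closed walk at positions i and j leaves two arcs. Summing over the base
  point z glues the piece from j to the end and the piece from the start to i into one arc of n - (j
  - i) steps.\<close>

lemma wsum_closed:
  assumes "finite S" "i \<le> j" "j \<le> n"
  shows "(\<Sum>z\<in>S. wsum S P n z (\<lambda>w. of_bool (w ! n = z \<and> Q (w ! i) (w ! j))))
    = (\<Sum>x\<in>S. \<Sum>y\<in>S. of_bool (Q x y) * kpow S P (j - i) x y * kpow S P (n - (j - i)) y x)"
proof -
  have "wsum S P n z (\<lambda>w. of_bool (w ! n = z \<and> Q (w ! i) (w ! j)))
      = (\<Sum>x\<in>S. \<Sum>y\<in>S. of_bool (Q x y) * kpow S P (j - i) x y * (kpow S P (n - j) y z * kpow S P i z x))"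
    if z: "z \<in> S" for z
  proof -
    have "(\<Sum>z'\<in>S. kpow S P (n - j) y z' * of_bool (z' = z \<and> Q x y)) = kpow S P (n - j) y z * of_bool (Q x y)" for x y
    proof -
      have "(\<Sum>z'\<in>S. kpow S P (n - j) y z' * of_bool (z' = z \<and> Q x y))
          = (\<Sum>z'\<in>S. if z' = z then kpow S P (n - j) y z' * of_bool (Q x y) else 0)"
        by (intro sum.cong) auto
      then show ?thesis using z assms(1) by simp
    qed
    then have "wsum S P n z (\<lambda>w. of_bool (w ! n = z \<and> Q (w ! i) (w ! j)))
      = (\<Sum>x\<in>S. kpow S P i z x * (\<Sum>y\<in>S. kpow S P (j - i) x y * (kpow S P (n - j) y z * of_bool (Q x y))))"
      using wsum_three[OF assms(1) z assms(2,3), of P "\<lambda>x y z'. of_bool (z' = z \<and> Q x y)"] by simp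
    then show ?thesis by (simp add: sum_distrib_left mult_ac)
  qed
  then have "(\<Sum>z\<in>S. wsum S P n z (\<lambda>w. of_bool (w ! n = z \<and> Q (w ! i) (w ! j))))
    = (\<Sum>z\<in>S. \<Sum>x\<in>S. \<Sum>y\<in>S. of_bool (Q x y) * kpow S P (j - i) x y * (kpow S P (n - j) y z * kpow S P i z x))"
    by simp
  also have "\<dots> = (\<Sum>x\<in>S. \<Sum>z\<in>S. \<Sum>y\<in>S. of_bool (Q x y) * kpow S P (j - i) x y * (kpow S P (n - j) y z * kpow S P i z x))"
    by (rule sum.swap)
  also have "\<dots> = (\<Sum>x\<in>S. \<Sum>y\<in>S. \<Sum>z\<in>S. of_bool (Q x y) * kpow S P (j - i) x y * (kpow S P (n - j) y z * kpow S P i z x))"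
    by (intro sum.cong refl sum.swap)
  also have "\<dots> = (\<Sum>x\<in>S. \<Sum>y\<in>S. of_bool (Q x y) * kpow S P (j - i) x y * kpow S P (n - j + i) y x)"
    using assms(1) by (simp add: kpow_add sum_distrib_left)
  also have "n - j + i = n - (j - i)" using assms by simp
  finally show ?thesis .
qed

section \<open>Closed walks of a reversible kernel\<close>

lemma weighted_Cauchy_Schwarz:
  fixes c :: "'a \<Rightarrow> real"
  assumes "\<And>i. i \<in> I \<Longrightarrow> \<alpha> i \<ge> 0" "\<And>i. i \<in> I \<Longrightarrow> \<beta> i \<ge> 0" "\<And>i. i \<in> I \<Longrightarrow> c i = sqrt (\<alpha> i * \<beta> i)"
  shows "(\<Sum>i\<in>I. c i * u i * v i)\<^sup>2 \<le> (\<Sum>i\<in>I. \<alpha> i * (u i)\<^sup>2) * (\<Sum>i\<in>I. \<beta> i * (v i)\<^sup>2)"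
proof -
  have "(\<Sum>i\<in>I. c i * u i * v i) = (\<Sum>i\<in>I. (sqrt (\<alpha> i) * u i) * (sqrt (\<beta> i) * v i))"
    by (intro sum.cong) (auto simp: assms(3) real_sqrt_mult)
  also have "\<dots>\<^sup>2 \<le> (\<Sum>i\<in>I. (sqrt (\<alpha> i) * u i)\<^sup>2) * (\<Sum>i\<in>I. (sqrt (\<beta> i) * v i)\<^sup>2)"
    by (rule Cauchy_Schwarz_ineq_sum)
  also have "\<dots> = (\<Sum>i\<in>I. \<alpha> i * (u i)\<^sup>2) * (\<Sum>i\<in>I. \<beta> i * (v i)\<^sup>2)"
    by (intro arg_cong2[where f = "(*)"] sum.cong) (auto simp: power_mult_distrib assms(1,2))
  finally show ?thesis .
qed

text \<open>A finite weighted graph without vertices of degree zero. It is used twice: for the given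
  graph, and for the graph of tuples.\<close>

locale reversible_kernel =
  fixes S :: "'a set" and p :: "'a \<Rightarrow> 'a \<Rightarrow> real"
  assumes finite_S: "finite S"
    and nonempty_S: "S \<noteq> {}"
    and p_nonneg: "x \<in> S \<Longrightarrow> y \<in> S \<Longrightarrow> p x y \<ge> 0"
    and p_sym: "x \<in> S \<Longrightarrow> y \<in> S \<Longrightarrow> p x y = p y x"
    and deg_pos': "x \<in> S \<Longrightarrow> (\<Sum>y\<in>S. p x y) > 0"
begin

definition deg :: "'a \<Rightarrow> real" where "deg x = (\<Sum>y\<in>S. p x y)"

definition P :: "'a \<Rightarrow> 'a \<Rightarrow> real" where "P x y = p x y / deg x"

abbreviation pw :: "nat \<Rightarrow> 'a \<Rightarrow> 'a \<Rightarrow> real" where "pw \<equiv> kpow S P"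

text \<open>Only even powers are considered, because their traces are sums of squares
  (\<open>tr_square\<close>).\<close>

definition tr :: "nat \<Rightarrow> real" where "tr q = (\<Sum>x\<in>S. pw (2 * q) x x)"

lemma deg_pos: "x \<in> S \<Longrightarrow> deg x > 0"
  using deg_pos' by (simp add: deg_def)

lemma P_nonneg: "x \<in> S \<Longrightarrow> y \<in> S \<Longrightarrow> P x y \<ge> 0"
  using p_nonneg deg_pos by (simp add: P_def less_imp_le)

lemma pw_nonneg: "x \<in> S \<Longrightarrow> pw q x y \<ge> 0"
  using P_nonneg by (rule kpow_nonneg)

lemma P_stochastic: "x \<in> S \<Longrightarrow> (\<Sum>y\<in>S. P x y) = 1"
  using deg_pos[of x] by (simp add: P_def deg_def flip: sum_divide_distrib)

lemma pw_stochastic: "x \<in> S \<Longrightarrow> (\<Sum>y\<in>S. pw q x y) = 1"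
proof (induction q arbitrary: x)
  case 0
  then show ?case using finite_S by simp
next
  case (Suc q)
  have "(\<Sum>y\<in>S. pw (Suc q) x y) = (\<Sum>z\<in>S. \<Sum>y\<in>S. P x z * pw q z y)"
    unfolding kpow.simps by (rule sum.swap)
  then show ?case using Suc by (simp add: P_stochastic flip: sum_distrib_left)
qed

text \<open>Detailed balance for one step, transported along the walk: the induction splits off the
  first step on one side and the last step on the other.\<close>

lemma pw_reversible:
  assumes "x \<in> S" "y \<in> S"
  shows "deg x * pw q x y = deg y * pw q y x"
  using assms
proof (induction q arbitrary: x)
  case (Suc q)
  have "deg x * P x z * pw q z y = deg y * (pw q y z * P z x)" if "z \<in> S" for z
  proof -
    have "deg x * P x z = deg z * P z x"
      using Suc.prems that deg_pos[of x] deg_pos[of z] p_sym[of x z] by (simp add: P_def)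
    then show ?thesis using Suc.IH[OF that Suc.prems(2)] by (simp add: algebra_simps)
  qed
  then have "deg x * pw (Suc q) x y = (\<Sum>z\<in>S. deg y * (pw q y z * P z x))"
    by (simp add: sum_distrib_left mult.assoc)
  also have "\<dots> = deg y * pw (Suc q) y x"
    unfolding kpow_Suc_right[OF finite_S Suc.prems(2,1)] by (simp add: sum_distrib_left)
  finally show ?case .
qed auto

lemma pw_reverse: "x \<in> S \<Longrightarrow> y \<in> S \<Longrightarrow> pw q y x = pw q x y * deg x / deg y"
  using pw_reversible[of x y q] deg_pos[of y] by (simp add: field_simps)

section \<open>Traces of even powers and their log-convexity\<close>

lemma tr_split:
  assumes "q + r = 2 * s"
  shows "tr s = (\<Sum>x\<in>S. \<Sum>y\<in>S. pw q x y * pw r y x)"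
  unfolding tr_def assms[symmetric] by (simp add: kpow_add finite_S)

text \<open>Conjugation by the square root of \<open>deg\<close> makes the walk matrix symmetric, so
  the trace of its 2q-th power is the sum of the squared entries of its q-th power.\<close>

lemma tr_square: "tr q = (\<Sum>x\<in>S. \<Sum>y\<in>S. deg x / deg y * (pw q x y)\<^sup>2)"
proof -
  have "pw q x y * pw q y x = deg x / deg y * (pw q x y)\<^sup>2" if "x \<in> S" "y \<in> S" for x y
    unfolding pw_reverse[OF that] by (simp add: power2_eq_square)
  then show ?thesis using tr_split[of q q q] by simp
qed

lemma tr_0: "tr 0 = card S"
  by (simp add: tr_def)

text \<open>With x and y independent and stationary, \<open>tr q\<close> is the mean of z^2 for z =
  \<open>pw q x y * D / deg y\<close>. Since z has mean 1, the tangent inequality z^2 \<ge> 2z - 1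
  gives the bound without eigenvalues.\<close>

lemma tr_ge_1: "tr q \<ge> 1"
proof -
  define D where "D = (\<Sum>x\<in>S. deg x)"
  have D: "D > 0" unfolding D_def using finite_S nonempty_S deg_pos by (intro sum_pos) auto
  have "deg x * deg y / D\<^sup>2 * (2 * (pw q x y * D / deg y) - 1) \<le> deg x / deg y * (pw q x y)\<^sup>2"
    if "x \<in> S" "y \<in> S" for x y
  proof -
    let ?z = "pw q x y * D / deg y"
    have "0 \<le> (?z - 1)\<^sup>2" by simp
    then have "2 * ?z - 1 \<le> ?z\<^sup>2" by (simp add: power2_eq_square algebra_simps)
    then have "deg x * deg y / D\<^sup>2 * (2 * ?z - 1) \<le> deg x * deg y / D\<^sup>2 * ?z\<^sup>2"
      using that deg_pos by (intro mult_left_mono) (auto simp: less_imp_le)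
    also have "\<dots> = deg x / deg y * (pw q x y)\<^sup>2"
      using D deg_pos[of y] that by (simp add: field_simps power2_eq_square)
    finally show ?thesis .
  qed
  then have "(\<Sum>x\<in>S. \<Sum>y\<in>S. deg x * deg y / D\<^sup>2 * (2 * (pw q x y * D / deg y) - 1)) \<le> tr q"
    unfolding tr_square by (intro sum_mono) auto
  also have "(\<Sum>x\<in>S. \<Sum>y\<in>S. deg x * deg y / D\<^sup>2 * (2 * (pw q x y * D / deg y) - 1))
    = (\<Sum>x\<in>S. \<Sum>y\<in>S. 2 / D * deg x * pw q x y - deg x / D\<^sup>2 * deg y)"
  proof (intro sum.cong refl)
    fix x y assume "y \<in> S"
    from deg_pos[OF this] D
    show "deg x * deg y / D\<^sup>2 * (2 * (pw q x y * D / deg y) - 1) = 2 / D * deg x * pw q x y - deg x / D\<^sup>2 * deg y"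
      by (simp add: field_simps power2_eq_square)
  qed
  also have "\<dots> = (\<Sum>x\<in>S. 2 / D * deg x - deg x / D\<^sup>2 * D)"
    by (intro sum.cong refl)
       (simp only: sum_subtractf D_def pw_stochastic mult_1_right flip: sum_distrib_left)
  also have "\<dots> = (\<Sum>x\<in>S. deg x / D)"
    using D by (intro sum.cong refl) (simp add: field_simps power2_eq_square)
  also have "\<dots> = 1"
    using D by (simp add: D_def flip: sum_divide_distrib)
  finally show ?thesis .
qed

lemma tr_pos: "tr q > 0"
  using tr_ge_1[of q] by simp

lemma tr_log_convex: "(tr (Suc q))\<^sup>2 \<le> tr q * tr (Suc (Suc q))"
proof -
  have "tr (Suc q) = (\<Sum>x\<in>S. \<Sum>y\<in>S. pw q x y * pw (Suc (Suc q)) y x)"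
    by (rule tr_split) simp
  also have "\<dots> = (\<Sum>x\<in>S. \<Sum>y\<in>S. deg x / deg y * pw q x y * pw (Suc (Suc q)) x y)"
  proof (intro sum.cong refl)
    fix x y assume "x \<in> S" "y \<in> S"
    from pw_reverse[OF this, of "Suc (Suc q)"]
    show "pw q x y * pw (Suc (Suc q)) y x = deg x / deg y * pw q x y * pw (Suc (Suc q)) x y"
      by (simp del: kpow.simps)
  qed
  also have "\<dots> = (\<Sum>(x, y)\<in>S \<times> S. deg x / deg y * pw q x y * pw (Suc (Suc q)) x y)"
    by (rule sum.cartesian_product)
  finally have eq: "tr (Suc q) = \<dots>" .
  show ?thesis
    unfolding eq tr_square[of q] tr_square[of "Suc (Suc q)"] sum.cartesian_product case_prod_unfold
    by (rule weighted_Cauchy_Schwarz, simp_all only: real_sqrt_abs2) (auto simp: deg_pos less_imp_le)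
qed

text \<open>Interpolation between \<open>tr 0\<close> and \<open>tr (Suc q)\<close> with the roots
  cleared. The induction raises log-convexity to the power \<open>Suc q\<close> and cancels
  \<open>tr (Suc q) ^ q\<close>.\<close>

lemma tr_power_bound: "tr q ^ Suc q \<le> tr (Suc q) ^ q * card S"
proof (induction q)
  case 0
  then show ?case by (simp add: tr_0)
next
  case (Suc q)
  have "tr (Suc q) ^ q * tr (Suc q) ^ Suc (Suc q) = ((tr (Suc q))\<^sup>2) ^ Suc q"
  proof -
    have "q + Suc (Suc q) = 2 * Suc q" by simp
    then show ?thesis by (simp only: flip: power_add power_mult)
  qed
  also have "\<dots> \<le> (tr q * tr (Suc (Suc q))) ^ Suc q"
    by (intro power_mono tr_log_convex) simp
  also have "\<dots> = tr q ^ Suc q * tr (Suc (Suc q)) ^ Suc q"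
    by (rule power_mult_distrib)
  also have "\<dots> \<le> (tr (Suc q) ^ q * card S) * tr (Suc (Suc q)) ^ Suc q"
    using tr_pos[of "Suc (Suc q)"] by (intro mult_right_mono Suc.IH) simp
  finally have "tr (Suc q) ^ q * tr (Suc q) ^ Suc (Suc q)
      \<le> tr (Suc q) ^ q * (tr (Suc (Suc q)) ^ Suc q * card S)"
    by (simp only: mult_ac)
  moreover have "tr (Suc q) ^ q > 0" using tr_pos by simp
  ultimately show ?case by (rule mult_left_le_imp_le)
qed

text \<open>
  \<open>W y u v\<close> is the weight of the \<open>r\<close>-step walks from \<open>u\<close> to \<open>v\<close> that satisfy some condition
  involving \<open>y\<close>, the vertex following \<open>v\<close> on the closed walk.
\<close>

lemma restricted_walks_bound:
  assumes W: "\<And>y u v. y \<in> S \<Longrightarrow> u \<in> S \<Longrightarrow> v \<in> S \<Longrightarrow> 0 \<le> W y u v \<and> W y u v \<le> pw r u v"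
    and small: "\<And>u v. u \<in> S \<Longrightarrow> v \<in> S \<Longrightarrow> (\<Sum>y\<in>S. p v y * W y u v) \<le> \<eta> * deg v * pw r u v"
  shows "(\<Sum>y\<in>S. \<Sum>u\<in>S. \<Sum>v\<in>S. pw (Suc r) y u * W y u v * P v y)\<^sup>2 \<le> \<eta> * tr (Suc r) * tr r"
proof -
  let ?T = "S \<times> S \<times> S"
  \<comment> \<open>The two weights multiply to the square of \<open>P v y\<close>. In the first
    factor v is unrestricted, so summing it out yields \<open>deg y\<close> and the exact trace
    \<open>tr (Suc r)\<close>; the second factor carries the restriction.\<close>
  let ?\<alpha> = "\<Sum>(y, u, v)\<in>?T. p v y / deg u * (pw (Suc r) y u)\<^sup>2"
  let ?\<beta> = "\<Sum>(y, u, v)\<in>?T. p v y * deg u / (deg v)\<^sup>2 * (W y u v)\<^sup>2"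
  have eq: "(\<Sum>y\<in>S. \<Sum>u\<in>S. \<Sum>v\<in>S. pw (Suc r) y u * W y u v * P v y)
      = (\<Sum>(y, u, v)\<in>?T. P v y * pw (Suc r) y u * W y u v)"
    by (simp add: sum.cartesian_product mult_ac del: kpow.simps)
  have CS: "(\<Sum>(y, u, v)\<in>?T. P v y * pw (Suc r) y u * W y u v)\<^sup>2 \<le> ?\<alpha> * ?\<beta>"
    unfolding case_prod_unfold
  proof (rule weighted_Cauchy_Schwarz)
    fix i assume "i \<in> ?T"
    then obtain y u v where i: "i = (y, u, v)" "y \<in> S" "u \<in> S" "v \<in> S" by auto
    have "p v y / deg u * (p v y * deg u / (deg v)\<^sup>2) = (P v y)\<^sup>2"
      using i deg_pos[of u] by (simp add: P_def power2_eq_square)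
    then show "P (snd (snd i)) (fst i) = sqrt (p (snd (snd i)) (fst i) / deg (fst (snd i)) *
         (p (snd (snd i)) (fst i) * deg (fst (snd i)) / (deg (snd (snd i)))\<^sup>2))"
      using i P_nonneg by simp
  qed (auto simp: p_nonneg deg_pos less_imp_le)
  have "?\<alpha> = (\<Sum>y\<in>S. \<Sum>u\<in>S. \<Sum>v\<in>S. p y v * ((pw (Suc r) y u)\<^sup>2 / deg u))"
    by (simp add: sum.cartesian_product[symmetric] p_sym del: kpow.simps)
  also have "\<dots> = (\<Sum>y\<in>S. \<Sum>u\<in>S. deg y / deg u * (pw (Suc r) y u)\<^sup>2)"
  proof (intro sum.cong refl)
    fix y u
    show "(\<Sum>v\<in>S. p y v * ((pw (Suc r) y u)\<^sup>2 / deg u)) = deg y / deg u * (pw (Suc r) y u)\<^sup>2"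
      unfolding deg_def[of y] sum_distrib_right[symmetric] by simp
  qed
  also have "\<dots> = tr (Suc r)" by (simp only: tr_square)
  finally have \<alpha>: "?\<alpha> = tr (Suc r)" .
  have \<beta>: "?\<beta> \<le> \<eta> * tr r"
  proof -
    have "?\<beta> = (\<Sum>y\<in>S. \<Sum>u\<in>S. \<Sum>v\<in>S. p v y * deg u / (deg v)\<^sup>2 * (W y u v)\<^sup>2)"
      by (simp add: sum.cartesian_product[symmetric])
    also have "\<dots> = (\<Sum>u\<in>S. \<Sum>y\<in>S. \<Sum>v\<in>S. p v y * deg u / (deg v)\<^sup>2 * (W y u v)\<^sup>2)"
      by (rule sum.swap)
    also have "\<dots> = (\<Sum>u\<in>S. \<Sum>v\<in>S. \<Sum>y\<in>S. p v y * deg u / (deg v)\<^sup>2 * (W y u v)\<^sup>2)"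
      by (intro sum.cong refl sum.swap)
    also have "\<dots> \<le> (\<Sum>u\<in>S. \<Sum>v\<in>S. \<eta> * (deg u / deg v * (pw r u v)\<^sup>2))"
    proof (intro sum_mono)
      fix u v assume uv: "u \<in> S" "v \<in> S"
      have "(\<Sum>y\<in>S. p v y * deg u / (deg v)\<^sup>2 * (W y u v)\<^sup>2)
          \<le> (\<Sum>y\<in>S. deg u / (deg v)\<^sup>2 * pw r u v * (p v y * W y u v))"
      proof (rule sum_mono)
        fix y assume y: "y \<in> S"
        \<comment> \<open>Only one of the two factors \<open>W\<close> is estimated by
          \<open>pw r u v\<close>; the other stays, so that the hypothesis \<open>small\<close>,
          which is linear in \<open>W\<close>, applies.\<close>
        have "(W y u v)\<^sup>2 \<le> pw r u v * W y u v"
          using W[OF y uv] by (simp add: power2_eq_square mult_right_mono)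
        then have "p v y * deg u / (deg v)\<^sup>2 * (W y u v)\<^sup>2 \<le> p v y * deg u / (deg v)\<^sup>2 * (pw r u v * W y u v)"
          using p_nonneg[OF uv(2) y] deg_pos[OF uv(1)] by (intro mult_left_mono) auto
        then show "p v y * deg u / (deg v)\<^sup>2 * (W y u v)\<^sup>2 \<le> deg u / (deg v)\<^sup>2 * pw r u v * (p v y * W y u v)"
          by (simp add: mult_ac)
      qed
      also have "\<dots> = deg u / (deg v)\<^sup>2 * pw r u v * (\<Sum>y\<in>S. p v y * W y u v)"
        by (simp add: sum_distrib_left)
      also have "\<dots> \<le> deg u / (deg v)\<^sup>2 * pw r u v * (\<eta> * deg v * pw r u v)"
        using deg_pos[OF uv(1)] pw_nonneg[OF uv(1)] by (intro mult_left_mono small uv) auto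
      also have "\<dots> = \<eta> * (deg u / deg v * (pw r u v)\<^sup>2)"
        using deg_pos[OF uv(2)] by (simp add: power2_eq_square field_simps)
      finally show "(\<Sum>y\<in>S. p v y * deg u / (deg v)\<^sup>2 * (W y u v)\<^sup>2) \<le> \<eta> * (deg u / deg v * (pw r u v)\<^sup>2)" .
    qed
    also have "\<dots> = \<eta> * tr r" by (simp add: tr_square sum_distrib_left)
    finally show ?thesis .
  qed
  have "?\<alpha> * ?\<beta> \<le> tr (Suc r) * (\<eta> * tr r)"
    unfolding \<alpha> using tr_pos[of "Suc r"] by (intro mult_left_mono \<beta>) simp
  with CS show ?thesis unfolding eq by (simp only: mult_ac)
qed

text \<open>The closed walk is read as y, then u after r + 1 steps, then x after r - t, then v after
  t, then back to y. Because t \<le> r, the vertex x lies between the antipode u and the predecessor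
  v of y, so \<open>restricted_walks_bound\<close> applies with the conflict hidden in
  \<open>W\<close>.\<close>

lemma conflicting_walks_bound_short:
  assumes R: "\<And>v x. v \<in> S \<Longrightarrow> x \<in> S \<Longrightarrow> (\<Sum>y\<in>S. p v y * of_bool (R x y)) \<le> \<eta> * deg v"
    and t: "t \<le> r"
  shows "(\<Sum>x\<in>S. \<Sum>y\<in>S. of_bool (R x y) * pw (Suc t) x y * pw (2 * Suc r - Suc t) y x)\<^sup>2
    \<le> \<eta> * tr (Suc r) * tr r"
proof -
  define W where "W y u v = (\<Sum>x\<in>S. pw (r - t) u x * of_bool (R x y) * pw t x v)" for y u v
  have "(\<Sum>x\<in>S. \<Sum>y\<in>S. of_bool (R x y) * pw (Suc t) x y * pw (2 * Suc r - Suc t) y x)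
     = (\<Sum>x\<in>S. \<Sum>y\<in>S. \<Sum>u\<in>S. \<Sum>v\<in>S. pw (Suc r) y u * (pw (r - t) u x * of_bool (R x y) * pw t x v) * P v y)"
  proof (intro sum.cong refl)
    fix x y assume xy: "x \<in> S" "y \<in> S"
    have "2 * Suc r - Suc t = Suc r + (r - t)" using t by simp
    then have "pw (2 * Suc r - Suc t) y x = (\<Sum>u\<in>S. pw (Suc r) y u * pw (r - t) u x)"
      by (simp only: kpow_add[OF finite_S xy(2)])
    then have "of_bool (R x y) * pw (Suc t) x y * pw (2 * Suc r - Suc t) y x
      = of_bool (R x y) * (\<Sum>v\<in>S. pw t x v * P v y) * (\<Sum>u\<in>S. pw (Suc r) y u * pw (r - t) u x)"
      by (simp only: kpow_Suc_right[OF finite_S xy, of P t])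
    also have "\<dots> = (\<Sum>u\<in>S. \<Sum>v\<in>S. pw (Suc r) y u * (pw (r - t) u x * of_bool (R x y) * pw t x v) * P v y)"
      by (subst mult.assoc, subst mult.commute[of "sum _ _" "sum _ _"])
         (simp add: sum_product sum_distrib_left mult_ac del: kpow.simps)
    finally show "of_bool (R x y) * pw (Suc t) x y * pw (2 * Suc r - Suc t) y x
      = (\<Sum>u\<in>S. \<Sum>v\<in>S. pw (Suc r) y u * (pw (r - t) u x * of_bool (R x y) * pw t x v) * P v y)" .
  qed
  also have "\<dots> = (\<Sum>y\<in>S. \<Sum>x\<in>S. \<Sum>u\<in>S. \<Sum>v\<in>S. pw (Suc r) y u * (pw (r - t) u x * of_bool (R x y) * pw t x v) * P v y)"
    by (rule sum.swap)
  also have "\<dots> = (\<Sum>y\<in>S. \<Sum>u\<in>S. \<Sum>x\<in>S. \<Sum>v\<in>S. pw (Suc r) y u * (pw (r - t) u x * of_bool (R x y) * pw t x v) * P v y)"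
    by (intro sum.cong refl sum.swap)
  also have "\<dots> = (\<Sum>y\<in>S. \<Sum>u\<in>S. \<Sum>v\<in>S. \<Sum>x\<in>S. pw (Suc r) y u * (pw (r - t) u x * of_bool (R x y) * pw t x v) * P v y)"
    by (intro sum.cong refl sum.swap)
  also have "\<dots> = (\<Sum>y\<in>S. \<Sum>u\<in>S. \<Sum>v\<in>S. pw (Suc r) y u * W y u v * P v y)"
    by (simp add: W_def sum_distrib_left sum_distrib_right del: kpow.simps)
  also have "\<dots>\<^sup>2 \<le> \<eta> * tr (Suc r) * tr r"
  proof (rule restricted_walks_bound)
    have pw_r: "pw r u v = (\<Sum>x\<in>S. pw (r - t) u x * pw t x v)" if "u \<in> S" for u v
      using kpow_add[OF finite_S that, of P "r - t" t v] t by simp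
    fix u v assume uv: "u \<in> S" "v \<in> S"
    show "0 \<le> W y u v \<and> W y u v \<le> pw r u v" if "y \<in> S" for y
      unfolding W_def pw_r[OF uv(1)]
      by (intro conjI sum_nonneg sum_mono mult_nonneg_nonneg mult_right_mono) (auto simp: pw_nonneg uv)
    have "(\<Sum>y\<in>S. p v y * W y u v) = (\<Sum>y\<in>S. \<Sum>x\<in>S. pw (r - t) u x * pw t x v * (p v y * of_bool (R x y)))"
      by (simp add: W_def sum_distrib_left mult_ac)
    also have "\<dots> = (\<Sum>x\<in>S. \<Sum>y\<in>S. pw (r - t) u x * pw t x v * (p v y * of_bool (R x y)))"
      by (rule sum.swap)
    also have "\<dots> = (\<Sum>x\<in>S. pw (r - t) u x * pw t x v * (\<Sum>y\<in>S. p v y * of_bool (R x y)))"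
      by (simp only: sum_distrib_left)
    also have "\<dots> \<le> (\<Sum>x\<in>S. pw (r - t) u x * pw t x v * (\<eta> * deg v))"
      by (intro sum_mono mult_left_mono R mult_nonneg_nonneg pw_nonneg uv)
    also have "\<dots> = \<eta> * deg v * pw r u v"
      by (simp add: pw_r[OF uv(1)] sum_distrib_left mult_ac)
    finally show "(\<Sum>y\<in>S. p v y * W y u v) \<le> \<eta> * deg v * pw r u v" .
  qed
  finally show ?thesis .
qed

text \<open>One of the two arcs between x and y has at most r + 1 steps; by symmetry of
  \<open>R\<close> the roles of x and y can be exchanged to make it the arc from x to y.\<close>

lemma conflicting_walks_bound:
  assumes sym: "\<And>x y. R x y \<Longrightarrow> R y x"
    and R: "\<And>v x. v \<in> S \<Longrightarrow> x \<in> S \<Longrightarrow> (\<Sum>y\<in>S. p v y * of_bool (R x y)) \<le> \<eta> * deg v"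
    and t: "0 < t" "t < 2 * Suc r"
  shows "(\<Sum>x\<in>S. \<Sum>y\<in>S. of_bool (R x y) * pw t x y * pw (2 * Suc r - t) y x)\<^sup>2
    \<le> \<eta> * tr (Suc r) * tr r"
proof (cases "t \<le> Suc r")
  case True
  with t have t': "t = Suc (t - 1)" "t - 1 \<le> r" by auto
  show ?thesis by (subst (1 2) t'(1)) (rule conflicting_walks_bound_short[OF R t'(2)])
next
  case False
  define s where "s = 2 * Suc r - t - 1"
  have s: "s \<le> r" "2 * Suc r - t = Suc s" "t = 2 * Suc r - Suc s" using False t by (auto simp: s_def)
  have RR: "R x y = R y x" for x y using sym by blast
  have "(\<Sum>x\<in>S. \<Sum>y\<in>S. of_bool (R x y) * pw t x y * pw (2 * Suc r - t) y x)
     = (\<Sum>y\<in>S. \<Sum>x\<in>S. of_bool (R x y) * pw t x y * pw (2 * Suc r - t) y x)"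
    by (rule sum.swap)
  also have "\<dots> = (\<Sum>y\<in>S. \<Sum>x\<in>S. of_bool (R y x) * pw (Suc s) y x * pw (2 * Suc r - Suc s) x y)"
  proof (intro sum.cong refl)
    fix x y
    show "of_bool (R x y) * pw t x y * pw (2 * Suc r - t) y x
      = of_bool (R y x) * pw (Suc s) y x * pw (2 * Suc r - Suc s) x y"
      unfolding s(2) s(3)[symmetric] RR[of x y] by (simp only: mult_ac)
  qed
  finally show ?thesis using conflicting_walks_bound_short[OF R s(1)] by simp
qed

text \<open>The same cut for a condition on y alone: \<open>W\<close> is then either zero or all of
  \<open>pw r u v\<close>.\<close>

lemma bad_walks_bound:
  assumes "\<And>v. v \<in> S \<Longrightarrow> (\<Sum>y\<in>S. p v y * of_bool (B y)) \<le> \<eta> * deg v"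
  shows "(\<Sum>y\<in>S. of_bool (B y) * pw (2 * Suc r) y y)\<^sup>2 \<le> \<eta> * tr (Suc r) * tr r"
proof -
  have "pw (2 * Suc r) y y = (\<Sum>u\<in>S. \<Sum>v\<in>S. pw (Suc r) y u * pw r u v * P v y)" if y: "y \<in> S" for y
  proof -
    have "pw (2 * Suc r) y y = (\<Sum>u\<in>S. pw (Suc r) y u * pw (Suc r) u y)"
      unfolding mult_2 by (rule kpow_add[OF finite_S y])
    also have "\<dots> = (\<Sum>u\<in>S. pw (Suc r) y u * (\<Sum>v\<in>S. pw r u v * P v y))"
      by (intro sum.cong refl) (simp only: kpow_Suc_right[OF finite_S _ y])
    finally show ?thesis by (simp only: sum_distrib_left mult.assoc)
  qed
  then have "(\<Sum>y\<in>S. of_bool (B y) * pw (2 * Suc r) y y)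
     = (\<Sum>y\<in>S. \<Sum>u\<in>S. \<Sum>v\<in>S. pw (Suc r) y u * (of_bool (B y) * pw r u v) * P v y)"
    by (simp add: sum_distrib_left mult_ac del: kpow.simps mult_Suc_right)
  also have "\<dots>\<^sup>2 \<le> \<eta> * tr (Suc r) * tr r"
  proof (rule restricted_walks_bound)
    fix u v assume uv: "u \<in> S" "v \<in> S"
    show "0 \<le> of_bool (B y) * pw r u v \<and> of_bool (B y) * pw r u v \<le> pw r u v" for y
      using pw_nonneg[OF uv(1)] by auto
    have "(\<Sum>y\<in>S. p v y * (of_bool (B y) * pw r u v)) = (\<Sum>y\<in>S. p v y * of_bool (B y)) * pw r u v"
      by (simp add: sum_distrib_right mult.assoc)
    also have "\<dots> \<le> \<eta> * deg v * pw r u v"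
      by (intro mult_right_mono assms uv pw_nonneg)
    finally show "(\<Sum>y\<in>S. p v y * (of_bool (B y) * pw r u v)) \<le> \<eta> * deg v * pw r u v" .
  qed
  finally show ?thesis .
qed

text \<open>Union bound: the closed walks of length 2m have total weight \<open>tr m\<close>, and if
  all of them fail, then \<open>tr m\<close> is at most 4m^2 times the square root of
  \<open>\<eta> * tr m * tr (m - 1)\<close>. Log-convexity and \<open>tr m \<ge> 1\<close>
  contradict this for small \<open>\<eta>\<close>.\<close>

theorem conflict_free_closed_walk:
  assumes sym: "\<And>x y. R x y \<Longrightarrow> R y x"
    and R: "\<And>v x. v \<in> S \<Longrightarrow> x \<in> S \<Longrightarrow> (\<Sum>y\<in>S. p v y * of_bool (R x y)) \<le> \<eta> * deg v"
    and B: "\<And>v. v \<in> S \<Longrightarrow> (\<Sum>y\<in>S. p v y * of_bool (B y)) \<le> \<eta> * deg v"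
    and m: "m > 0" and \<eta>: "\<eta> \<ge> 0"
    and small: "(16 * real m ^ 4 * \<eta>) ^ m * card S < 1"
  obtains w where "length w = Suc (2 * m)" "set w \<subseteq> S" "w ! (2 * m) = w ! 0"
    "\<And>i. i < 2 * m \<Longrightarrow> p (w ! i) (w ! Suc i) > 0"
    "\<And>i. i < 2 * m \<Longrightarrow> \<not> B (w ! i)"
    "\<And>i j. i < j \<Longrightarrow> j < 2 * m \<Longrightarrow> \<not> R (w ! i) (w ! j)"
proof (rule ccontr)
  assume neg: "\<not> thesis"
  obtain r where r: "m = Suc r" using m by (cases m) auto
  \<comment> \<open>Diagonal pairs encode the condition \<open>B\<close> on one vertex, so a single
    union over pairs covers both kinds of failure.\<close>
  define Q where "Q = (\<lambda>(i::nat, j::nat) x y. if i = j then B x else R x y)"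
  define J where "J = {(i, j). i \<le> j \<and> j < 2 * m}"
  have J: "J \<subseteq> {..<2 * m} \<times> {..<2 * m}" by (auto simp: J_def)
  then have fin_J: "finite J" by (rule finite_subset) simp
  have "card J \<le> card ({..<2 * m} \<times> {..<2 * m})" using J by (rule card_mono[rotated]) simp
  then have "real (card J) \<le> real (2 * m * (2 * m))" by (simp only: card_cartesian_product card_lessThan of_nat_le_iff)
  then have card_J: "real (card J) \<le> 4 * real m ^ 2" by (simp add: power2_eq_square)
  let ?X = "\<eta> * tr (Suc r) * tr r"
  have bound: "(\<Sum>z\<in>S. wsum S P (2 * m) z (\<lambda>w. of_bool (w ! (2 * m) = z \<and> Q (i, j) (w ! i) (w ! j)))) \<le> sqrt ?X"
    if "(i, j) \<in> J" for i j
  proof -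
    have ij: "i \<le> j" "j < 2 * m" using that by (auto simp: J_def)
    have eq: "(\<Sum>z\<in>S. wsum S P (2 * m) z (\<lambda>w. of_bool (w ! (2 * m) = z \<and> Q (i, j) (w ! i) (w ! j))))
      = (\<Sum>x\<in>S. \<Sum>y\<in>S. of_bool (Q (i, j) x y) * pw (j - i) x y * pw (2 * m - (j - i)) y x)"
      using ij by (intro wsum_closed finite_S) auto
    have "(\<Sum>x\<in>S. \<Sum>y\<in>S. of_bool (Q (i, j) x y) * pw (j - i) x y * pw (2 * m - (j - i)) y x)\<^sup>2 \<le> ?X"
    proof (cases "i = j")
      case True
      have "(\<Sum>y\<in>S. of_bool (Q (i, j) x y) * pw (j - i) x y * pw (2 * m - (j - i)) y x)
         = of_bool (B x) * pw (2 * Suc r) x x" if x: "x \<in> S" for x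
      proof -
        have "(\<Sum>y\<in>S. of_bool (Q (i, j) x y) * pw (j - i) x y * pw (2 * m - (j - i)) y x)
          = (\<Sum>y\<in>S. if x = y then of_bool (B y) * pw (2 * Suc r) y y else 0)"
          using True by (intro sum.cong) (auto simp: Q_def r)
        then show ?thesis using x finite_S by simp
      qed
      then show ?thesis using bad_walks_bound[of B \<eta> r, OF B] by simp
    next
      case False
      then show ?thesis
        using conflicting_walks_bound[of R \<eta> "j - i" r, OF sym R] ij by (simp add: Q_def r)
    qed
    then show ?thesis unfolding eq by (rule real_le_rsqrt)
  qed
  have "tr m = (\<Sum>z\<in>S. wsum S P (2 * m) z (\<lambda>w. of_bool (w ! (2 * m) = z)))"
    unfolding tr_def
  proof (intro sum.cong refl)
    fix z assume z: "z \<in> S"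
    have "wsum S P (2 * m) z (\<lambda>w. of_bool (w ! (2 * m) = z)) = (\<Sum>z'\<in>S. pw (2 * m) z z' * of_bool (z' = z))"
      using wsum_last[OF finite_S z, of P "2 * m" "\<lambda>z'. of_bool (z' = z)"] .
    also have "\<dots> = (\<Sum>z'\<in>S. if z' = z then pw (2 * m) z z' else 0)"
      by (intro sum.cong) auto
    finally show "pw (2 * m) z z = wsum S P (2 * m) z (\<lambda>w. of_bool (w ! (2 * m) = z))"
      using z finite_S by simp
  qed
  \<comment> \<open>Under the assumption that no good walk exists, each closed walk of positive
    weight violates the condition of some pair in \<open>J\<close>.\<close>
  also have "\<dots> \<le> (\<Sum>z\<in>S. wsum S P (2 * m) z (\<lambda>w. \<Sum>a\<in>J. of_bool (w ! (2 * m) = z \<and> Q a (w ! fst a) (w ! snd a))))"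
  proof (intro sum_mono wsum_mono)
    fix z w assume z: "z \<in> S" and w: "length w = Suc (2 * m)" "w ! 0 = z" "set w \<subseteq> S"
      "\<forall>i<2 * m. 0 < P (w ! i) (w ! Suc i)"
    show "of_bool (w ! (2 * m) = z) \<le> (\<Sum>a\<in>J. of_bool (w ! (2 * m) = z \<and> Q a (w ! fst a) (w ! snd a)) :: real)"
    proof (cases "w ! (2 * m) = z")
      case True
      have pos: "p (w ! i) (w ! Suc i) > 0" if "i < 2 * m" for i
      proof -
        have "w ! i \<in> S" using w(1,3) that by (auto simp: subset_iff)
        then show ?thesis using w(4) that deg_pos[of "w ! i"] by (auto simp: P_def zero_less_divide_iff)
      qed
      have "\<exists>a\<in>J. Q a (w ! fst a) (w ! snd a)"
      proof (rule ccontr)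
        assume contra: "\<not> (\<exists>a\<in>J. Q a (w ! fst a) (w ! snd a))"
        have nQ: "\<not> Q (i, j) (w ! i) (w ! j)" if "i \<le> j" "j < 2 * m" for i j
          using contra that by (force simp: J_def)
        have "\<not> B (w ! i)" if "i < 2 * m" for i
          using nQ[of i i] that by (simp add: Q_def)
        moreover have "\<not> R (w ! i) (w ! j)" if "i < j" "j < 2 * m" for i j
          using nQ[of i j] that by (simp add: Q_def)
        ultimately have thesis using that[of w] w True pos by simp
        then show False using neg by simp
      qed
      then obtain a where a: "a \<in> J" "Q a (w ! fst a) (w ! snd a)" by blast
      have "(1::real) = of_bool (w ! (2 * m) = z \<and> Q a (w ! fst a) (w ! snd a))" using a True by simp
      also have "\<dots> \<le> (\<Sum>a\<in>J. of_bool (w ! (2 * m) = z \<and> Q a (w ! fst a) (w ! snd a)))"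
        by (rule member_le_sum[OF a(1)]) (auto simp: fin_J)
      finally show ?thesis using True by simp
    qed (simp add: sum_nonneg)
  qed (auto simp: P_nonneg)
  also have "\<dots> = (\<Sum>a\<in>J. \<Sum>z\<in>S. wsum S P (2 * m) z (\<lambda>w. of_bool (w ! (2 * m) = z \<and> Q a (w ! fst a) (w ! snd a))))"
    unfolding wsum_sum by (rule sum.swap)
  also have "\<dots> \<le> (\<Sum>a\<in>J. sqrt ?X)"
    using bound by (intro sum_mono) auto
  also have "\<dots> = card J * sqrt ?X" by simp
  also have "\<dots> \<le> 4 * real m ^ 2 * sqrt ?X"
    using card_J \<eta> tr_pos[of r] tr_pos[of "Suc r"] by (intro mult_right_mono) auto
  finally have "(tr m)\<^sup>2 \<le> (4 * real m ^ 2 * sqrt ?X)\<^sup>2"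
    using tr_pos[of m] by (intro power_mono) auto
  also have "\<dots> = 16 * real m ^ 4 * ?X"
    using \<eta> tr_pos[of r] tr_pos[of "Suc r"] by (simp add: power_mult_distrib flip: power_mult)
  finally have "tr m * tr m \<le> tr m * (16 * real m ^ 4 * \<eta> * tr r)"
    by (simp add: r power2_eq_square mult_ac)
  then have "tr m \<le> 16 * real m ^ 4 * \<eta> * tr r"
    using tr_pos[of m] by (rule mult_left_le_imp_le)
  \<comment> \<open>The m-th power turns \<open>tr r\<close> into \<open>tr r ^ Suc r\<close>, to
    which \<open>tr_power_bound\<close> applies; cancelling \<open>tr m ^ r\<close> then leaves
    \<open>tr m\<close> below 1.\<close>
  then have "tr m ^ m \<le> (16 * real m ^ 4 * \<eta> * tr r) ^ m"
    using tr_pos[of m] by (intro power_mono) auto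
  also have "\<dots> = (16 * real m ^ 4 * \<eta>) ^ m * tr r ^ Suc r"
    by (simp only: power_mult_distrib r)
  also have "\<dots> \<le> (16 * real m ^ 4 * \<eta>) ^ m * (tr (Suc r) ^ r * card S)"
    using \<eta> by (intro mult_left_mono tr_power_bound) simp
  finally have "tr m ^ r * tr m \<le> tr m ^ r * ((16 * real m ^ 4 * \<eta>) ^ m * card S)"
    by (simp add: r mult_ac)
  moreover have "tr m ^ r > 0" using tr_pos by simp
  ultimately have "tr m \<le> (16 * real m ^ 4 * \<eta>) ^ m * card S" by (rule mult_left_le_imp_le)
  then show False using small tr_ge_1[of m] by simp
qed

end

section \<open>Dense subsets and sums over tuples\<close>

lemma heavy_subset:
  fixes p :: "'a \<Rightarrow> 'a \<Rightarrow> real"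
  assumes "finite S" and nonneg: "\<And>x y. x \<in> S \<Longrightarrow> y \<in> S \<Longrightarrow> p x y \<ge> 0"
    and sym: "\<And>x y. x \<in> S \<Longrightarrow> y \<in> S \<Longrightarrow> p x y = p y x"
    and heavy: "2 * (\<Sum>x\<in>S. c x) < (\<Sum>x\<in>S. \<Sum>y\<in>S. p x y)"
  obtains T where "T \<subseteq> S" "T \<noteq> {}" "\<And>x. x \<in> T \<Longrightarrow> c x < (\<Sum>y\<in>T. p x y)"
\<comment> \<open>Take a smallest subset still satisfying the density hypothesis.\<close>
proof -
  define H where "H T \<longleftrightarrow> T \<subseteq> S \<and> 2 * (\<Sum>x\<in>T. c x) < (\<Sum>x\<in>T. \<Sum>y\<in>T. p x y)" for T
  have "H S" using heavy by (simp add: H_def)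
  then obtain T where T: "H T" and min: "\<And>U. H U \<Longrightarrow> card T \<le> card U"
    using arg_min_natI[of H S card] arg_min_nat_le[of H _ card] by blast
  have TS: "T \<subseteq> S" using T by (simp add: H_def)
  then have fin: "finite T" using \<open>finite S\<close> finite_subset by blast
  have "c x < (\<Sum>y\<in>T. p x y)" if x: "x \<in> T" for x
  proof (rule ccontr)
    assume light: "\<not> c x < (\<Sum>y\<in>T. p x y)"
    let ?U = "T - {x}"
    have split: "(\<Sum>y\<in>T. h y) = h x + (\<Sum>y\<in>?U. h y)" for h :: "'a \<Rightarrow> real"
      using fin x by (rule sum.remove)
    \<comment> \<open>Deleting x costs its row and its column, at most twice its degree in
      \<open>T\<close> and so at most \<open>2 * c x\<close>. The density hypothesis therefore
      survives in \<open>?U\<close>, against minimality.\<close>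
    have "(\<Sum>y\<in>T. \<Sum>z\<in>T. p y z) = (\<Sum>z\<in>T. p x z) + (\<Sum>y\<in>?U. p y x) + (\<Sum>y\<in>?U. \<Sum>z\<in>?U. p y z)"
      unfolding split[of "\<lambda>y. \<Sum>z\<in>T. p y z"] by (simp only: split[of "p _"] sum.distrib add.assoc)
    also have "(\<Sum>y\<in>?U. p y x) \<le> (\<Sum>y\<in>T. p x y)"
    proof -
      have "(\<Sum>y\<in>?U. p y x) = (\<Sum>y\<in>?U. p x y)" using TS x by (intro sum.cong refl sym) auto
      then show ?thesis using split[of "p x"] nonneg[of x x] TS x by auto
    qed
    finally have "H ?U"
      using T light split[of c] TS by (auto simp: H_def)
    then have "card T \<le> card ?U" by (rule min)
    moreover have "card ?U < card T" using fin x by (rule card_Diff1_less)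
    ultimately show False by simp
  qed
  moreover have "T \<noteq> {}" using T by (auto simp: H_def)
  ultimately show thesis using TS that by blast
qed

section \<open>Sums over tuples\<close>

lemma kpow_kpow:
  assumes "finite S" "x \<in> S"
  shows "kpow S (kpow S P m) n x y = kpow S P (m * n) x y"
  using assms(2) by (induction n arbitrary: x) (auto simp: kpow_add[OF assms(1)])

lemma sum_PiE_insert:
  assumes "i \<notin> I"
  shows "(\<Sum>a\<in>Pi\<^sub>E (insert i I) T. F a) = (\<Sum>y\<in>T i. \<Sum>a\<in>Pi\<^sub>E I T. F (a(i := y)))"
proof -
  have "(\<Sum>a\<in>Pi\<^sub>E (insert i I) T. F a) = (\<Sum>(y, a)\<in>T i \<times> Pi\<^sub>E I T. F (a(i := y)))"
    unfolding PiE_insert_eq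
    by (subst sum.reindex[OF inj_combinator[OF assms]]) (auto intro: sum.cong)
  then show ?thesis by (simp add: sum.cartesian_product)
qed

text \<open>Transfer matrix method: summing out the interior coordinates of a tuple multiplies the
  matrices along it.\<close>

lemma sum_PiE_walks:
  assumes "finite V"
  shows "(\<Sum>a\<in>Pi\<^sub>E {..q} (\<lambda>_. V). (\<Prod>j<q. Q (a j) (a (Suc j))) * G (a 0) (a q))
    = (\<Sum>x\<in>V. \<Sum>y\<in>V. kpow V Q q x y * G x y)"
proof (induction q arbitrary: G)
  case 0
  have "(\<Sum>y\<in>V. kpow V Q 0 x y * G x y) = (\<Sum>y\<in>V. if x = y then G x y else 0)" for x
    by (intro sum.cong) auto
  moreover have "{..0::nat} = insert 0 {}" by auto
  ultimately show ?case using assms by (simp add: sum_PiE_insert)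
next
  case (Suc q)
  have "{..Suc q} = insert (Suc q) {..q}" by auto
  then have "(\<Sum>a\<in>Pi\<^sub>E {..Suc q} (\<lambda>_. V). (\<Prod>j<Suc q. Q (a j) (a (Suc j))) * G (a 0) (a (Suc q)))
    = (\<Sum>y\<in>V. \<Sum>a\<in>Pi\<^sub>E {..q} (\<lambda>_. V). (\<Prod>j<q. Q (a j) (a (Suc j))) * (Q (a q) y * G (a 0) y))"
    by (simp add: sum_PiE_insert mult.assoc)
  also have "\<dots> = (\<Sum>y\<in>V. \<Sum>x\<in>V. \<Sum>z\<in>V. kpow V Q q x z * (Q z y * G x y))"
    by (intro sum.cong refl Suc.IH)
  also have "\<dots> = (\<Sum>x\<in>V. \<Sum>y\<in>V. \<Sum>z\<in>V. kpow V Q q x z * (Q z y * G x y))"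
    by (rule sum.swap)
  also have "\<dots> = (\<Sum>x\<in>V. \<Sum>y\<in>V. kpow V Q (Suc q) x y * G x y)"
  proof (intro sum.cong refl)
    fix x y assume "x \<in> V" "y \<in> V"
    from kpow_Suc_right[OF assms this, of Q q]
    show "(\<Sum>z\<in>V. kpow V Q q x z * (Q z y * G x y)) = kpow V Q (Suc q) x y * G x y"
      by (simp add: sum_distrib_right mult.assoc del: kpow.simps)
  qed
  finally show ?case .
qed

text \<open>As \<open>\<psi>\<close> ignores coordinate i, fixing the other coordinates leaves at
  most one admissible value for it, of weight at most M; the remaining sum factorizes.\<close>

lemma sum_PiE_determined_coordinate:
  fixes f :: "'v \<Rightarrow> real"
  assumes "finite I" "i \<in> I" "\<And>j. j \<in> I \<Longrightarrow> finite (B j)"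
    and f: "\<And>j y. j \<in> I \<Longrightarrow> y \<in> B j \<Longrightarrow> 0 \<le> f y \<and> f y \<le> M" and "M \<ge> 0"
    and \<psi>: "\<And>b y. \<psi> (b(i := y)) = \<psi> b"
  shows "(\<Sum>b\<in>Pi\<^sub>E I B. (\<Prod>j\<in>I. f (b j)) * of_bool (b i = \<psi> b)) \<le> M * (\<Prod>j\<in>I - {i}. \<Sum>y\<in>B j. f y)"
proof -
  let ?I = "I - {i}"
  have I: "I = insert i ?I" using assms(2) by auto
  have nonneg: "(\<Prod>j\<in>?I. f (b j)) \<ge> 0" if "b \<in> Pi\<^sub>E ?I B" for b
    using that f by (intro prod_nonneg) (auto simp: PiE_mem)
  have "(\<Sum>b\<in>Pi\<^sub>E I B. (\<Prod>j\<in>I. f (b j)) * of_bool (b i = \<psi> b))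
     = (\<Sum>b\<in>Pi\<^sub>E (insert i ?I) B. (\<Prod>j\<in>insert i ?I. f (b j)) * of_bool (b i = \<psi> b))"
    by (simp only: I[symmetric])
  also have "\<dots> = (\<Sum>y\<in>B i. \<Sum>b\<in>Pi\<^sub>E ?I B. (\<Prod>j\<in>?I. f (b j)) * (f y * of_bool (y = \<psi> b)))"
  proof -
    have "(\<Prod>j\<in>insert i ?I. f ((b(i := y)) j)) = f y * (\<Prod>j\<in>?I. f (b j))" for b y
    proof -
      have "(\<Prod>j\<in>?I. f ((b(i := y)) j)) = (\<Prod>j\<in>?I. f (b j))" by (rule prod.cong) auto
      then show ?thesis using assms(1) by (subst prod.insert) auto
    qed
    then show ?thesis by (subst sum_PiE_insert) (simp_all add: \<psi> mult.assoc mult.left_commute)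
  qed
  also have "\<dots> = (\<Sum>b\<in>Pi\<^sub>E ?I B. (\<Prod>j\<in>?I. f (b j)) * (\<Sum>y\<in>B i. f y * of_bool (y = \<psi> b)))"
    by (subst sum.swap) (simp add: sum_distrib_left)
  also have "\<dots> \<le> (\<Sum>b\<in>Pi\<^sub>E ?I B. (\<Prod>j\<in>?I. f (b j)) * M)"
  proof (intro sum_mono mult_left_mono nonneg)
    fix b
    have "(\<Sum>y\<in>B i. f y * of_bool (y = \<psi> b)) = (\<Sum>y\<in>B i. if y = \<psi> b then f y else 0)"
      by (intro sum.cong) auto
    also have "\<dots> \<le> M" using assms(2,3,5) f by simp
    finally show "(\<Sum>y\<in>B i. f y * of_bool (y = \<psi> b)) \<le> M" .
  qed
  also have "\<dots> = M * (\<Prod>j\<in>?I. \<Sum>y\<in>B j. f y)"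
    by (subst prod_sum_PiE) (use assms in \<open>auto simp: sum_distrib_left mult.commute\<close>)
  finally show ?thesis .
qed

lemma sum_PiE_reindex:
  assumes "bij_betw \<pi> I I"
  shows "(\<Sum>a\<in>Pi\<^sub>E I (\<lambda>_. V). F a) = (\<Sum>a\<in>Pi\<^sub>E I (\<lambda>_. V). F (\<lambda>i\<in>I. a (\<pi> i)))"
proof (rule sum.reindex_bij_betw[symmetric])
  let ?\<rho> = "inv_into I \<pi>"
  have \<rho>: "\<And>i. i \<in> I \<Longrightarrow> ?\<rho> i \<in> I \<and> \<pi> (?\<rho> i) = i \<and> ?\<rho> (\<pi> i) = i \<and> \<pi> i \<in> I"
    using assms by (auto simp: bij_betw_def inv_into_into f_inv_into_f)
  show "bij_betw (\<lambda>a. \<lambda>i\<in>I. a (\<pi> i)) (Pi\<^sub>E I (\<lambda>_. V)) (Pi\<^sub>E I (\<lambda>_. V))"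
    by (rule bij_betw_byWitness[where f' = "\<lambda>a. \<lambda>i\<in>I. a (?\<rho> i)"])
       (use \<rho> in \<open>auto simp: PiE_iff extensional_def fun_eq_iff\<close>)
qed

section \<open>Closed walks of tuples in a graph of large minimum degree\<close>

text \<open>
  The cyclic \<open>2l\<close>-walk through \<open>a\<close> and \<open>b\<close> visits \<open>a\<^sub>j, b\<^sub>-\<^sub>j, a\<^sub>j\<^sub>+\<^sub>1\<close> consecutively. Reversing the
  indices of \<open>b\<close> is what makes the relation symmetric.
\<close>

definition index_adj :: "nat \<Rightarrow> nat \<Rightarrow> nat \<Rightarrow> bool" where
  "index_adj l i j \<longleftrightarrow> (i + j) mod l \<in> {0, 1}"

definition tuple_adj :: "nat \<Rightarrow> ('v \<Rightarrow> 'v \<Rightarrow> bool) \<Rightarrow> (nat \<Rightarrow> 'v) \<Rightarrow> (nat \<Rightarrow> 'v) \<Rightarrow> bool" where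
  "tuple_adj l A a b \<longleftrightarrow> (\<forall>i<l. \<forall>j<l. index_adj l i j \<longrightarrow> A (a i) (b j))"

lemma bij_betw_rotate:
  fixes c l :: nat
  assumes "c \<le> l"
  shows "bij_betw (\<lambda>i. (i + c) mod l) {..<l} {..<l}"
proof (rule bij_betw_byWitness[where f' = "\<lambda>i. (i + (l - c)) mod l"])
  have "((i + c) mod l + (l - c)) mod l = (i + l) mod l" "((i + (l - c)) mod l + c) mod l = (i + l) mod l" for i
    using assms by (simp_all only: mod_add_left_eq add.assoc le_add_diff_inverse le_add_diff_inverse2)
  then show "\<forall>i\<in>{..<l}. ((i + c) mod l + (l - c)) mod l = i" "\<forall>i\<in>{..<l}. ((i + (l - c)) mod l + c) mod l = i"
    by simp_all
qed auto

lemma bij_betw_negate: "bij_betw (\<lambda>j. (l - j) mod l) {..<l::nat} {..<l}"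
proof (rule bij_betw_byWitness[where f' = "\<lambda>j. (l - j) mod l"])
  show "\<forall>j\<in>{..<l}. (l - (l - j) mod l) mod l = j" "\<forall>j\<in>{..<l}. (l - (l - j) mod l) mod l = j"
    by (auto simp: mod_if)
qed auto

text \<open>In the cyclic walk, coordinate -j of the second tuple sits between coordinates j and j +
  1 of the first.\<close>

lemma negate_index:
  fixes i j l :: nat
  assumes "i < l" "j < l" "2 \<le> l"
  shows "index_adj l i ((l - j) mod l) \<longleftrightarrow> i = j \<or> i = (j + 1) mod l"
proof -
  have "(i + (l - j) mod l) mod l = (if j \<le> i then i - j else i + l - j)"
    using assms by (auto simp: mod_simps mod_if)
  moreover have "(j + 1) mod l = (if j + 1 = l then 0 else j + 1)" using assms by auto
  ultimately show ?thesis unfolding index_adj_def using assms by (auto split: if_splits)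
qed

locale min_degree_graph =
  fixes V :: "'v set" and A :: "'v \<Rightarrow> 'v \<Rightarrow> bool" and \<delta> :: real and l :: nat
  assumes finite_V: "finite V" and nonempty_V: "V \<noteq> {}"
    and A_sym: "A x y \<Longrightarrow> A y x"
    and \<delta>_pos: "\<delta> > 0"
    and min_degree: "x \<in> V \<Longrightarrow> \<delta> \<le> (\<Sum>y\<in>V. of_bool (A x y))"
    and l_ge_2: "l \<ge> 2"

sublocale min_degree_graph \<subseteq> G: reversible_kernel V "\<lambda>x y. of_bool (A x y)"
proof
  show "(\<Sum>y\<in>V. of_bool (A x y)) > (0::real)" if "x \<in> V" for x
    using min_degree[OF that] \<delta>_pos by linarith
qed (auto simp: finite_V nonempty_V dest: A_sym)

context min_degree_graph
begin

abbreviation I :: "nat set" where "I \<equiv> {..<l}"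

abbreviation Tup :: "(nat \<Rightarrow> 'v) set" where "Tup \<equiv> Pi\<^sub>E I (\<lambda>_. V)"

abbreviation f :: "'v \<Rightarrow> real" where "f x \<equiv> 1 / G.deg x"

definition wt :: "(nat \<Rightarrow> 'v) \<Rightarrow> real" where "wt a = (\<Prod>i\<in>I. f (a i))"

definition q :: "(nat \<Rightarrow> 'v) \<Rightarrow> (nat \<Rightarrow> 'v) \<Rightarrow> real" where
  "q a b = of_bool (tuple_adj l A a b) * (wt a * wt b)"

text \<open>The values allowed in coordinate j of a tuple adjacent to a. Adjacency is a condition on
  each coordinate separately, so the neighbourhood of a is the product of these sets.\<close>

definition nbrs :: "(nat \<Rightarrow> 'v) \<Rightarrow> nat \<Rightarrow> 'v set" where
  "nbrs a j = {y \<in> V. \<forall>i<l. index_adj l i j \<longrightarrow> A (a i) y}"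

abbreviation Q :: "'v \<Rightarrow> 'v \<Rightarrow> real" where "Q \<equiv> G.pw 2"

text \<open>Up to a factor \<open>1 / \<delta>\<close>, the k-th summand bounds the weight of the
  neighbours of a whose k-th coordinate is prescribed.\<close>

definition cost :: "(nat \<Rightarrow> 'v) \<Rightarrow> real" where
  "cost a = wt a * (\<Sum>k\<in>I. \<Prod>j\<in>I - {k}. \<Sum>y\<in>nbrs a j. f y)"

section \<open>Weights of tuples and of their neighbourhoods\<close>

lemma \<delta>_le_deg: "x \<in> V \<Longrightarrow> \<delta> \<le> G.deg x"
  using min_degree by (simp add: G.deg_def)

lemma f_bounds: "x \<in> V \<Longrightarrow> 0 \<le> f x \<and> f x \<le> 1 / \<delta>"
  using \<delta>_le_deg[of x] \<delta>_pos by (auto simp: frac_le)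

lemma wt_nonneg: "a \<in> Tup \<Longrightarrow> wt a \<ge> 0"
  unfolding wt_def using f_bounds by (intro prod_nonneg) (auto simp: PiE_mem)

lemma q_nonneg: "a \<in> Tup \<Longrightarrow> b \<in> Tup \<Longrightarrow> q a b \<ge> 0"
  by (simp add: q_def wt_nonneg)

lemma tuple_adj_sym: "tuple_adj l A a b \<longleftrightarrow> tuple_adj l A b a"
  unfolding tuple_adj_def index_adj_def using A_sym by (metis add.commute)

lemma q_sym: "q a b = q b a"
  by (simp add: q_def tuple_adj_sym[of a b] mult.commute[of "wt a"])

lemma nbrs_subset: "nbrs a j \<subseteq> V"
  by (auto simp: nbrs_def)

lemma finite_nbrs: "finite (nbrs a j)"
  using nbrs_subset finite_V by (rule finite_subset)

lemma finite_Tup: "finite Tup"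
  using finite_V by (intro finite_PiE) auto

lemma tuple_neighbourhood: "{b \<in> Tup. tuple_adj l A a b} = Pi\<^sub>E I (nbrs a)"
  unfolding set_eq_iff mem_Collect_eq PiE_iff tuple_adj_def nbrs_def by blast

lemma sum_q: "(\<Sum>b\<in>Tup. q a b * h b) = wt a * (\<Sum>b\<in>Pi\<^sub>E I (nbrs a). wt b * h b)"
proof -
  have "(\<Sum>b\<in>Tup. q a b * h b) = (\<Sum>b\<in>Tup. if tuple_adj l A a b then wt a * (wt b * h b) else 0)"
    by (intro sum.cong) (auto simp: q_def)
  also have "\<dots> = (\<Sum>b\<in>{b \<in> Tup. tuple_adj l A a b}. wt a * (wt b * h b))"
    using finite_Tup by (simp add: sum.If_cases Int_def)
  finally show ?thesis by (simp only: tuple_neighbourhood sum_distrib_left)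
qed

lemma nbrs_negate:
  assumes "j < l"
  shows "nbrs a ((l - j) mod l) = {y \<in> V. A (a j) y \<and> A (a ((j + 1) mod l)) y}"
proof -
  define j' where "j' = (j + 1) mod l"
  have j': "j' < l" using l_ge_2 by (simp add: j'_def)
  have "index_adj l i ((l - j) mod l) \<longleftrightarrow> i = j \<or> i = j'" if "i < l" for i
    unfolding j'_def using that assms l_ge_2 by (rule negate_index)
  then show ?thesis using assms j' unfolding nbrs_def j'_def[symmetric] by blast
qed

text \<open>A common neighbour z is the midpoint of a two-step walk, of probability
  \<open>f x * f z\<close>; the endpoint y contributes no factor.\<close>

lemma two_step:
  assumes "x \<in> V" "y \<in> V"
  shows "f x * (\<Sum>z\<in>{z \<in> V. A x z \<and> A y z}. f z) = Q x y"
proof -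
  have "Q x y = (\<Sum>z\<in>V. G.P x z * G.P z y)"
    using kpow_Suc_right[OF finite_V assms, of G.P "Suc 0"] kpow_1[OF finite_V, of _ G.P x]
    by (simp add: numeral_2_eq_2 cong: sum.cong)
  also have "\<dots> = (\<Sum>z\<in>V. if A x z \<and> A y z then f x * f z else 0)"
    by (intro sum.cong) (auto simp: G.P_def dest: A_sym)
  also have "\<dots> = (\<Sum>z\<in>{z \<in> V. A x z \<and> A y z}. f x * f z)"
    using finite_V by (simp add: sum.If_cases Int_def)
  finally show ?thesis by (simp only: sum_distrib_left)
qed

text \<open>Each vertex weight is paired with the common neighbourhood that follows it on the cycle.
  The set \<open>K\<close> is all of \<open>I\<close> for the total weight and misses one index for
  the cost.\<close>

lemma prod_nbrs:
  assumes a: "a \<in> Tup" and K: "K \<subseteq> I"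
  shows "(\<Prod>j\<in>K. f (a j)) * (\<Prod>j\<in>(\<lambda>j. (l - j) mod l) ` K. \<Sum>y\<in>nbrs a j. f y)
    = (\<Prod>j\<in>K. Q (a j) (a ((j + 1) mod l)))"
proof -
  have "inj_on (\<lambda>j. (l - j) mod l) K"
    using bij_betw_negate K by (auto simp: bij_betw_def intro: inj_on_subset)
  then have "(\<Prod>j\<in>(\<lambda>j. (l - j) mod l) ` K. \<Sum>y\<in>nbrs a j. f y)
    = (\<Prod>j\<in>K. \<Sum>y\<in>nbrs a ((l - j) mod l). f y)"
    by (simp add: prod.reindex)
  then show ?thesis
    unfolding prod.distrib[symmetric]
  proof (simp only: flip: prod.distrib, intro prod.cong refl)
    fix j assume "j \<in> K"
    then have j: "j < l" using K by auto
    then have "a j \<in> V" "a ((j + 1) mod l) \<in> V" 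
      using PiE_mem[OF a, of j] PiE_mem[OF a, of "(j + 1) mod l"] l_ge_2 by simp_all
    then show "f (a j) * (\<Sum>y\<in>nbrs a ((l - j) mod l). f y) = Q (a j) (a ((j + 1) mod l))"
      unfolding nbrs_negate[OF j] by (rule two_step)
  qed
qed

section \<open>Total weight and total cost\<close>

lemma sum_q_total: "(\<Sum>a\<in>Tup. \<Sum>b\<in>Tup. q a b) = G.tr l"
proof -
  obtain r where r: "l = Suc r" using l_ge_2 by (cases l) auto
  have "(\<Sum>b\<in>Tup. q a b) = (\<Prod>j<r. Q (a j) (a (Suc j))) * Q (a r) (a 0)" if a: "a \<in> Tup" for a
  proof -
    have "(\<Sum>b\<in>Tup. q a b) = wt a * (\<Sum>b\<in>Pi\<^sub>E I (nbrs a). wt b)"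
      using sum_q[of a "\<lambda>_. 1"] by simp
    also have "(\<Sum>b\<in>Pi\<^sub>E I (nbrs a). wt b) = (\<Prod>j\<in>I. \<Sum>y\<in>nbrs a j. f y)"
      unfolding wt_def by (rule prod_sum_PiE[symmetric]) (auto simp: finite_nbrs)
    also have "wt a * \<dots> = (\<Prod>j\<in>I. Q (a j) (a ((j + 1) mod l)))"
      using prod_nbrs[OF a order.refl] bij_betw_negate[of l] by (simp add: wt_def bij_betw_def)
    also have "\<dots> = (\<Prod>j<r. Q (a j) (a (Suc j))) * Q (a r) (a 0)"
      by (simp add: r)
    finally show ?thesis .
  qed
  then have "(\<Sum>a\<in>Tup. \<Sum>b\<in>Tup. q a b)
     = (\<Sum>a\<in>Pi\<^sub>E {..r} (\<lambda>_. V). (\<Prod>j<r. Q (a j) (a (Suc j))) * Q (a r) (a 0))"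
    by (simp add: r lessThan_Suc_atMost)
  \<comment> \<open>The r = l - 1 steps along the tuple and the closing step together form the l-th
    power of \<open>Q\<close>, which is the 2l-th power of the walk.\<close>
  also have "\<dots> = (\<Sum>x\<in>V. \<Sum>y\<in>V. kpow V Q r x y * Q y x)"
    by (rule sum_PiE_walks[OF finite_V, where Q = Q and G = "\<lambda>x y. Q y x"])
  also have "\<dots> = (\<Sum>x\<in>V. \<Sum>y\<in>V. G.pw (2 * r) x y * Q y x)"
    by (intro sum.cong refl) (simp only: kpow_kpow[OF finite_V])
  also have "\<dots> = G.tr l"
    by (rule G.tr_split[symmetric]) (simp add: r)
  finally show ?thesis .
qed

text \<open>Without the factor \<open>Q\<close> at k, the cycle opens into a walk from coordinate k
  + 1 to coordinate k. As \<open>Q\<close> is stochastic, each starting vertex contributes at most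
  \<open>1 / \<delta>\<close>.\<close>

lemma sum_open_walks:
  assumes k: "k < l"
  shows "(\<Sum>a\<in>Tup. f (a k) * (\<Prod>j\<in>I - {k}. Q (a j) (a ((j + 1) mod l)))) \<le> card V / \<delta>"
proof -
  obtain r where r: "l = Suc r" using l_ge_2 by (cases l) auto
  \<comment> \<open>The rotation that carries the last index r to k, placing the gap at the
    end.\<close>
  define \<pi> where "\<pi> i = (i + (k + 1)) mod l" for i
  have bij: "bij_betw \<pi> I I"
    unfolding \<pi>_def using k by (intro bij_betw_rotate) simp
  have "\<pi> r = (k + l) mod l" unfolding \<pi>_def r by (simp add: add.commute)
  then have \<pi>_r: "\<pi> r = k" using k by simp
  have \<pi>_I: "\<pi> ` (I - {r}) = I - {k}"
    using bij \<pi>_r r by (subst inj_on_image_set_diff[of \<pi> I]) (auto simp: bij_betw_def)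
  let ?\<Phi> = "\<lambda>k a. f (a k) * (\<Prod>j\<in>I - {k}. Q (a j) (a ((j + 1) mod l)))"
  have "?\<Phi> r (\<lambda>i\<in>I. a (\<pi> i)) = ?\<Phi> k a" for a
  proof -
    have "(\<Prod>j\<in>I - {r}. Q ((\<lambda>i\<in>I. a (\<pi> i)) j) ((\<lambda>i\<in>I. a (\<pi> i)) ((j + 1) mod l)))
       = (\<Prod>j\<in>I - {r}. Q (a (\<pi> j)) (a ((\<pi> j + 1) mod l)))"
      by (intro prod.cong) (auto simp: \<pi>_def mod_simps r)
    also have "\<dots> = (\<Prod>j\<in>\<pi> ` (I - {r}). Q (a j) (a ((j + 1) mod l)))"
      using bij by (subst prod.reindex) (auto simp: bij_betw_def intro: inj_on_subset)
    finally have "(\<Prod>j\<in>I - {r}. Q ((\<lambda>i\<in>I. a (\<pi> i)) j) ((\<lambda>i\<in>I. a (\<pi> i)) ((j + 1) mod l)))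
       = (\<Prod>j\<in>I - {k}. Q (a j) (a ((j + 1) mod l)))"
      by (simp only: \<pi>_I)
    moreover have "(\<lambda>i\<in>I. a (\<pi> i)) r = a k" using \<pi>_r r by simp
    ultimately show ?thesis by (simp only:)
  qed
  then have "(\<Sum>a\<in>Tup. ?\<Phi> k a) = (\<Sum>a\<in>Tup. ?\<Phi> r a)"
    using sum_PiE_reindex[OF bij, of "?\<Phi> r" V] by simp
  also have "\<dots> = (\<Sum>a\<in>Pi\<^sub>E {..r} (\<lambda>_. V). (\<Prod>j<r. Q (a j) (a (Suc j))) * f (a r))"
  proof (intro sum.cong)
    fix a
    have "I - {r} = {..<r}" by (auto simp: r)
    then have "(\<Prod>j\<in>I - {r}. Q (a j) (a ((j + 1) mod l))) = (\<Prod>j<r. Q (a j) (a (Suc j)))"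
      by (auto simp: r intro!: prod.cong)
    then show "?\<Phi> r a = (\<Prod>j<r. Q (a j) (a (Suc j))) * f (a r)" by (simp only: mult.commute)
  qed (simp add: r lessThan_Suc_atMost)
  also have "\<dots> = (\<Sum>x\<in>V. \<Sum>y\<in>V. kpow V Q r x y * f y)"
    by (rule sum_PiE_walks[OF finite_V, where Q = Q and G = "\<lambda>x y. f y"])
  also have "\<dots> \<le> (\<Sum>x\<in>V. \<Sum>y\<in>V. G.pw (2 * r) x y * (1 / \<delta>))"
    using f_bounds by (intro sum_mono) (simp only: kpow_kpow[OF finite_V] mult_left_mono G.pw_nonneg)
  also have "\<dots> = (\<Sum>x\<in>V. 1 / \<delta>)"
    by (intro sum.cong refl) (simp only: G.pw_stochastic mult_1_left flip: sum_distrib_right)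
  also have "\<dots> = card V / \<delta>"
    by simp
  finally show ?thesis .
qed

text \<open>Index reversal translates an omitted coordinate of the neighbour into an omitted
  two-step factor; each of the l choices is then an open walk.\<close>

lemma sum_cost: "(\<Sum>a\<in>Tup. cost a) \<le> l * (card V / \<delta>)"
proof -
  have "(\<Sum>a\<in>Tup. wt a * (\<Prod>j\<in>I - {k}. \<Sum>y\<in>nbrs a j. f y)) \<le> card V / \<delta>" if "k \<in> I" for k
  proof -
    define \<sigma> where "\<sigma> j = (l - j) mod l" for j
    have bij: "bij_betw \<sigma> I I" unfolding \<sigma>_def by (rule bij_betw_negate)
    then have "k \<in> \<sigma> ` I" using that by (simp only: bij_betw_def)
    then obtain k' where k': "k' \<in> I" "\<sigma> k' = k" by blast
    have img: "\<sigma> ` (I - {k'}) = I - {k}"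
      using bij k' by (subst inj_on_image_set_diff[of \<sigma> I]) (auto simp: bij_betw_def)
    have "wt a * (\<Prod>j\<in>I - {k}. \<Sum>y\<in>nbrs a j. f y)
       = f (a k') * (\<Prod>j\<in>I - {k'}. Q (a j) (a ((j + 1) mod l)))" if a: "a \<in> Tup" for a
    proof -
      have "wt a = f (a k') * (\<Prod>j\<in>I - {k'}. f (a j))"
        unfolding wt_def using k'(1) by (intro prod.remove) auto
      then show ?thesis
        using prod_nbrs[OF a, of "I - {k'}"] unfolding \<sigma>_def[symmetric] img by (simp add: mult.assoc)
    qed
    then show ?thesis using sum_open_walks[of k'] k'(1) by simp
  qed
  then have "(\<Sum>k\<in>I. \<Sum>a\<in>Tup. wt a * (\<Prod>j\<in>I - {k}. \<Sum>y\<in>nbrs a j. f y)) \<le> (\<Sum>k\<in>I. card V / \<delta>)"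
    by (rule sum_mono)
  then show ?thesis
    by (simp add: cost_def sum_distrib_left sum.swap[of _ I])
qed

lemma cost_nonneg: "a \<in> Tup \<Longrightarrow> cost a \<ge> 0"
  unfolding cost_def using f_bounds nbrs_subset
  by (intro mult_nonneg_nonneg wt_nonneg sum_nonneg prod_nonneg) blast+

text \<open>Union bound over the coordinate j that is forced and a label i for the value forced on
  it. The sum over i gives the factor l, and the bound on a single vertex weight gives
  \<open>1 / \<delta>\<close>.\<close>

lemma conflict_mass:
  assumes a: "a \<in> Tup"
    and E: "\<And>b. b \<in> Tup \<Longrightarrow> E b \<Longrightarrow> \<exists>i\<in>I. \<exists>j\<in>I. b j = \<psi> i j b"
    and \<psi>: "\<And>i j b y. \<psi> i j (b(j := y)) = \<psi> i j b"
  shows "(\<Sum>b\<in>Tup. q a b * of_bool (E b)) \<le> l / \<delta> * cost a"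
proof -
  have "of_bool (E b) \<le> (\<Sum>i\<in>I. \<Sum>j\<in>I. of_bool (b j = \<psi> i j b) :: real)" if b: "b \<in> Tup" for b
  proof (cases "E b")
    case True
    then obtain i j where ij: "i \<in> I" "j \<in> I" "b j = \<psi> i j b" using E[OF b] by blast
    have "of_bool (E b) = (of_bool (b j = \<psi> i j b) :: real)" using True ij by simp
    also have "\<dots> \<le> (\<Sum>j\<in>I. of_bool (b j = \<psi> i j b))"
      by (rule member_le_sum[OF ij(2)]) auto
    also have "\<dots> \<le> (\<Sum>i\<in>I. \<Sum>j\<in>I. of_bool (b j = \<psi> i j b))"
      by (rule member_le_sum[OF ij(1)]) (auto intro: sum_nonneg)
    finally show ?thesis .
  qed (simp add: sum_nonneg)
  then have "(\<Sum>b\<in>Tup. q a b * of_bool (E b)) \<le> (\<Sum>b\<in>Tup. q a b * (\<Sum>i\<in>I. \<Sum>j\<in>I. of_bool (b j = \<psi> i j b)))"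
    using a by (intro sum_mono mult_left_mono q_nonneg)
  also have "\<dots> = (\<Sum>i\<in>I. \<Sum>j\<in>I. \<Sum>b\<in>Tup. q a b * of_bool (b j = \<psi> i j b))"
    by (simp only: sum_distrib_left sum.swap[of _ I Tup])
  also have "\<dots> \<le> (\<Sum>i\<in>I. \<Sum>j\<in>I. wt a * (1 / \<delta> * (\<Prod>j\<in>I - {j}. \<Sum>y\<in>nbrs a j. f y)))"
  proof (intro sum_mono)
    fix i j assume "i \<in> I" and j: "j \<in> I"
    show "(\<Sum>b\<in>Tup. q a b * of_bool (b j = \<psi> i j b)) \<le> wt a * (1 / \<delta> * (\<Prod>j\<in>I - {j}. \<Sum>y\<in>nbrs a j. f y))"
      unfolding sum_q wt_def[of "_ :: nat \<Rightarrow> 'v"]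
      by (intro mult_left_mono sum_PiE_determined_coordinate)
         (use a j \<delta>_pos \<psi> wt_nonneg f_bounds[OF subsetD[OF nbrs_subset]] finite_nbrs in \<open>auto simp flip: wt_def\<close>)
  qed
  also have "\<dots> = l / \<delta> * cost a"
    by (simp add: cost_def sum_distrib_left mult_ac)
  finally show ?thesis .
qed

text \<open>\<open>heavy_subset\<close> leaves tuples whose degree dominates their cost. Among them
  a step hits a prescribed coordinate with probability at most \<open>\<eta>\<close>, so
  \<open>conflict_free_closed_walk\<close> applies, with \<open>R\<close> for a common entry of two
  tuples and \<open>B\<close> for a repeated entry.\<close>

theorem closed_tuple_walk:
  assumes m: "m > 0"
    and small: "(48 * real m ^ 4 * real l ^ 2 * card V / \<delta>\<^sup>2) ^ m * card V ^ l < 1"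
  obtains w where "w ` {..2 * m} \<subseteq> Tup" "w (2 * m) = w 0"
    "\<And>i. i < 2 * m \<Longrightarrow> tuple_adj l A (w i) (w (Suc i))"
    "\<And>i. i < 2 * m \<Longrightarrow> inj_on (w i) I"
    "\<And>i i' j j'. i < 2 * m \<Longrightarrow> i' < 2 * m \<Longrightarrow> i \<noteq> i' \<Longrightarrow> j \<in> I \<Longrightarrow> j' \<in> I \<Longrightarrow> w i j \<noteq> w i' j'"
proof -
  \<comment> \<open>The factor 3 brings twice the total threshold down to 2/3, below the total
    weight, which is at least 1. With the 16 of the walk theorem it gives the 48.\<close>
  define \<eta> where "\<eta> = 3 * real l ^ 2 * card V / \<delta>\<^sup>2"
  have card_V: "card V > 0" using finite_V nonempty_V by (simp add: card_gt_0_iff)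
  then have \<eta>: "\<eta> > 0" using l_ge_2 \<delta>_pos by (simp add: \<eta>_def)
  let ?c = "\<lambda>a. l / \<delta> * cost a / \<eta>"
  have "2 * (\<Sum>a\<in>Tup. ?c a) = 2 * l / (\<delta> * \<eta>) * (\<Sum>a\<in>Tup. cost a)"
    by (simp add: sum_distrib_left sum_divide_distrib mult.assoc)
  also have "\<dots> \<le> 2 * l / (\<delta> * \<eta>) * (l * (card V / \<delta>))"
    using \<delta>_pos \<eta> by (intro mult_left_mono sum_cost) auto
  also have "\<dots> = 2 / 3"
    using \<delta>_pos card_V l_ge_2 by (simp add: \<eta>_def power2_eq_square field_simps)
  also have "\<dots> < (\<Sum>a\<in>Tup. \<Sum>b\<in>Tup. q a b)"
    using G.tr_ge_1[of l] by (simp add: sum_q_total)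
  finally obtain T where T: "T \<subseteq> Tup" "T \<noteq> {}" "\<And>a. a \<in> T \<Longrightarrow> ?c a < (\<Sum>b\<in>T. q a b)"
    using heavy_subset[of Tup q ?c thesis] finite_Tup q_nonneg q_sym by metis
  have fin_T: "finite T" using T(1) finite_Tup finite_subset by blast
  interpret H: reversible_kernel T q
  proof
    fix a assume a: "a \<in> T"
    have "0 \<le> ?c a" using cost_nonneg[of a] \<delta>_pos \<eta> a T(1) by auto
    then show "(\<Sum>b\<in>T. q a b) > 0" using T(3)[OF a] by linarith
  qed (use T(1,2) fin_T q_nonneg q_sym in \<open>auto simp: subset_iff\<close>)
  have mass: "(\<Sum>b\<in>T. q a b * of_bool (E b)) \<le> \<eta> * H.deg a"
    if a: "a \<in> T" and E: "\<And>b. b \<in> Tup \<Longrightarrow> E b \<Longrightarrow> \<exists>i\<in>I. \<exists>j\<in>I. b j = \<psi> i j b"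
      and \<psi>: "\<And>i j b y. \<psi> i j (b(j := y)) = \<psi> i j b"
    for a E and \<psi> :: "nat \<Rightarrow> nat \<Rightarrow> (nat \<Rightarrow> 'v) \<Rightarrow> 'v"
  proof -
    have aT: "a \<in> Tup" using a T(1) by blast
    \<comment> \<open>Passing to all tuples only increases the sum, and the cost bounds it there;
      membership of a in \<open>T\<close> turns the cost into the degree of a inside
      \<open>T\<close>.\<close>
    have "(\<Sum>b\<in>T. q a b * of_bool (E b)) \<le> (\<Sum>b\<in>Tup. q a b * of_bool (E b))"
      using T(1) finite_Tup q_nonneg[OF aT] by (intro sum_mono2) auto
    also have "\<dots> \<le> l / \<delta> * cost a" by (rule conflict_mass[OF aT E \<psi>])
    also have "\<dots> \<le> \<eta> * H.deg a"
    proof -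
      have "l / \<delta> * cost a < H.deg a * \<eta>"
        using T(3)[OF a] unfolding H.deg_def by (simp only: pos_divide_less_eq[OF \<eta>])
      then show ?thesis by (simp only: mult.commute[of \<eta>] less_imp_le)
    qed
    finally show ?thesis .
  qed
  define R where "R x y \<longleftrightarrow> (\<exists>i\<in>I. \<exists>j\<in>I. x i = y j)" for x y :: "nat \<Rightarrow> 'v"
  define B where "B y \<longleftrightarrow> \<not> inj_on y I" for y :: "nat \<Rightarrow> 'v"
  have small': "(16 * real m ^ 4 * \<eta>) ^ m * card T < 1"
  proof -
    have "card T \<le> card V ^ l"
      using card_mono[OF finite_Tup T(1)] by (simp add: card_PiE)
    then have "(16 * real m ^ 4 * \<eta>) ^ m * card T \<le> (16 * real m ^ 4 * \<eta>) ^ m * card V ^ l"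
      using \<eta> by (intro mult_left_mono) (auto simp flip: of_nat_power)
    also have "\<dots> < 1" using small by (simp add: \<eta>_def mult.assoc)
    finally show ?thesis .
  qed
  have R_sym: "R y x" if "R x y" for x y using that unfolding R_def by metis
  have R_mass: "(\<Sum>y\<in>T. q v y * of_bool (R x y)) \<le> \<eta> * H.deg v" if "v \<in> T" "x \<in> T" for v x
    by (rule mass[OF that(1), of _ "\<lambda>i j b. x i"]) (auto simp: R_def intro: sym)
  have B_mass: "(\<Sum>y\<in>T. q v y * of_bool (B y)) \<le> \<eta> * H.deg v" if "v \<in> T" for v
    \<comment> \<open>The value forced on coordinate j must not depend on that coordinate. The
      default for i = j ensures this, and a repeated entry always supplies distinct indices.\<close>
    by (rule mass[OF that, of _ "\<lambda>i j b. if i = j then undefined else b i"])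
       (fastforce simp: B_def inj_on_def)+
  obtain w where w: "length w = Suc (2 * m)" "set w \<subseteq> T" "w ! (2 * m) = w ! 0"
    "\<And>i. i < 2 * m \<Longrightarrow> q (w ! i) (w ! Suc i) > 0"
    "\<And>i. i < 2 * m \<Longrightarrow> \<not> B (w ! i)"
    "\<And>i j. i < j \<Longrightarrow> j < 2 * m \<Longrightarrow> \<not> R (w ! i) (w ! j)"
    by (rule H.conflict_free_closed_walk[of R \<eta> B m, OF R_sym R_mass B_mass m less_imp_le[OF \<eta>] small']) blast+
  show thesis
  proof (rule that[of "\<lambda>i. w ! i"])
    show "(!) w ` {..2 * m} \<subseteq> Tup"
      using w(1,2) T(1) by (force simp: subset_iff)
    show "w ! (2 * m) = w ! 0" by (rule w(3))
    show "tuple_adj l A (w ! i) (w ! Suc i)" if "i < 2 * m" for i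
      using w(4)[OF that] by (cases "tuple_adj l A (w ! i) (w ! Suc i)") (simp_all add: q_def)
    show "inj_on (w ! i) I" if "i < 2 * m" for i
      using w(5)[OF that] by (simp add: B_def)
    show "(w ! i) j \<noteq> (w ! i') j'" if "i < 2 * m" "i' < 2 * m" "i \<noteq> i'" "j \<in> I" "j' \<in> I" for i i' j j'
      using w(6)[of i i'] w(6)[of i' i] that unfolding R_def by (metis linorder_neqE_nat)
  qed
qed

end

section \<open>Copies of the torus\<close>

text \<open>Tuple adjacency depends on index sums modulo l, so every second row is reversed:
  straight edges then have sum 0 and slanted edges sum 1. Column l receives index 0 in every
  row.\<close>

definition torus_index :: "nat \<Rightarrow> nat \<Rightarrow> nat \<Rightarrow> nat" where
  "torus_index l i j = (if odd i then j mod l else l - j)"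

lemma torus_index_less: "j \<in> {1..l} \<Longrightarrow> torus_index l i j < l"
  by (auto simp: torus_index_def)

lemma inj_on_torus_index: "inj_on (torus_index l i) {1..l}"
proof (rule inj_onI)
  fix x y assume "x \<in> {1..l}" "y \<in> {1..l}" "torus_index l i x = torus_index l i y"
  then show "x = y"
    by (cases "x = l"; cases "y = l") (auto simp: torus_index_def split: if_splits)
qed

lemma cyc_in: "m > 0 \<Longrightarrow> cyc m x \<in> {1..m}"
  by (auto simp: cyc_def Suc_le_eq)

lemma torus_contained:
  assumes k: "even k" "k > 0" and l: "l \<ge> 2" and UV: "U \<subseteq> V"
    and w: "\<And>i. i \<le> k \<Longrightarrow> w i \<in> Pi\<^sub>E {..<l} (\<lambda>_. U)"
    and closed: "w k = w 0"
    and adj: "\<And>i. i < k \<Longrightarrow> tuple_adj l (\<lambda>x y. {x, y} \<in> E) (w i) (w (Suc i))"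
    and inj: "\<And>i. i < k \<Longrightarrow> inj_on (w i) {..<l}"
    and disj: "\<And>i i' j j'. i < k \<Longrightarrow> i' < k \<Longrightarrow> i \<noteq> i' \<Longrightarrow> j \<in> {..<l} \<Longrightarrow> j' \<in> {..<l} \<Longrightarrow> w i j \<noteq> w i' j'"
  shows "contains_copy V E (torus_V k l) (torus_E k l)"
proof -
  \<comment> \<open>Torus rows are numbered from 1, the walk from 0.\<close>
  define f where "f = (\<lambda>(i, j). w (i - 1) (torus_index l i j))"
  have edge: "{f (i, j), f (cyc k i, j')} \<in> E"
    if i: "i \<in> {1..k}" and j: "j \<in> {1..l}" and j': "j' \<in> {1..l}"
      and idx: "index_adj l (torus_index l i j) (torus_index l (Suc i) j')" for i j j'
  proof -
    have "w (cyc k i - 1) = w i" using i closed by (cases "i = k") (auto simp: cyc_def)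
    \<comment> \<open>Evenness of k is used at i = k: row 1, which follows row k, has the parity of
      k + 1.\<close>
    moreover have "odd (cyc k i) \<longleftrightarrow> odd (Suc i)"
      using i k by (cases "i = k") (auto simp: cyc_def)
    then have "torus_index l (cyc k i) j' = torus_index l (Suc i) j'" by (simp only: torus_index_def)
    moreover have "tuple_adj l (\<lambda>x y. {x, y} \<in> E) (w (i - 1)) (w i)"
      using adj[of "i - 1"] i by auto
    ultimately show ?thesis
      using idx torus_index_less[OF j] torus_index_less[OF j'] by (auto simp: f_def tuple_adj_def)
  qed
  have cyc_l: "cyc l j \<in> {1..l}" for j using l by (intro cyc_in) simp
  have l_mod: "Suc l mod l = 1" using l by (simp add: mod_Suc)
  have cyc_mod: "cyc l j mod l = (j + 1) mod l" for j by (simp add: cyc_def mod_simps)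
  have "inj_on f (torus_V k l)"
  proof (rule inj_onI, clarify)
    fix i j i' j' assume m: "(i, j) \<in> torus_V k l" "(i', j') \<in> torus_V k l" and eq: "f (i, j) = f (i', j')"
    then have b: "i \<in> {1..k}" "j \<in> {1..l}" "i' \<in> {1..k}" "j' \<in> {1..l}" by (auto simp: torus_V_def)
    have idx: "torus_index l i j \<in> {..<l}" "torus_index l i' j' \<in> {..<l}"
      using torus_index_less b by blast+
    have "i - 1 = i' - 1"
      using disj[of "i - 1" "i' - 1", OF _ _ _ idx] b eq unfolding f_def by force
    then have i: "i = i'" using b by auto
    have "torus_index l i j = torus_index l i j'"
      using inj_onD[OF inj[of "i - 1"], of "torus_index l i j" "torus_index l i j'"] idx eq b i by (auto simp: f_def)
    then show "i = i' \<and> j = j'" using i inj_onD[OF inj_on_torus_index] b by blast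
  qed
  moreover have "f ` torus_V k l \<subseteq> V"
  proof clarify
    fix i j assume "(i, j) \<in> torus_V k l"
    then have "i - 1 \<le> k" "torus_index l i j \<in> {..<l}"
      using torus_index_less by (auto simp: torus_V_def)
    then show "f (i, j) \<in> V" using PiE_mem[OF w] UV by (auto simp: f_def)
  qed
  moreover have "f ` e \<in> E" if "e \<in> torus_E k l" for e
  proof -
    from that consider
      (straight) i j where "i \<in> {1..k}" "j \<in> {1..l}" "e = {(i, j), (cyc k i, j)}"
    | (odd) i j where "i \<in> {1..k}" "j \<in> {1..l}" "odd i" "e = {(i, cyc l j), (cyc k i, j)}"
    | (even) i j where "i \<in> {1..k}" "j \<in> {1..l}" "even i" "e = {(i, j), (cyc k i, cyc l j)}"
      unfolding torus_E_def by blast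
    then show ?thesis
    proof cases
      case straight
      have "index_adj l (torus_index l i j) (torus_index l (Suc i) j)"
      proof -
        have "(j mod l + (l - j)) mod l = (j + (l - j)) mod l" by (rule mod_add_left_eq)
        also have "j + (l - j) = l" using straight(2) by simp
        finally have "(j mod l + (l - j)) mod l = 0" by simp
        then show ?thesis
          by (cases "odd i") (simp_all only: index_adj_def torus_index_def even_Suc add.commute
              if_True if_False not_not insert_iff simp_thms)
      qed
      with edge[OF straight(1,2,2)] show ?thesis by (simp add: straight(3))
    next
      case odd
      have "(cyc l j mod l + (l - j)) mod l = (j + 1 + (l - j)) mod l"
        by (simp add: cyc_mod mod_simps)
      also have "j + 1 + (l - j) = l + 1" using odd(2) by simp
      finally have "index_adj l (torus_index l i (cyc l j)) (torus_index l (Suc i) j)"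
        using odd(3) l l_mod by (simp add: index_adj_def torus_index_def)
      with edge[OF odd(1) cyc_l odd(2)] show ?thesis by (simp add: odd(4))
    next
      case even
      have "((l - j) + cyc l j mod l) mod l = ((l - j) + (j + 1)) mod l"
        by (simp only: cyc_mod mod_simps)
      also have "(l - j) + (j + 1) = l + 1" using even(2) by simp
      finally have "index_adj l (torus_index l i j) (torus_index l (Suc i) (cyc l j))"
        using even(3) l l_mod by (simp add: index_adj_def torus_index_def)
      with edge[OF even(1,2) cyc_l] show ?thesis by (simp add: even(4))
    qed
  qed
  ultimately show ?thesis unfolding contains_copy_def by blast
qed

section \<open>From the number of edges to a copy of the torus\<close>

lemma torus_free_edge_bound:
  fixes k l n :: nat
  assumes k: "even k" "k \<ge> 4" and l: "l \<ge> 2" and n: "n \<ge> 1"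
    and E: "simple_graph {0..<n} E"
    and free: "\<not> contains_copy {0..<n} E (torus_V k l) (torus_E k l)"
  shows "card E \<le> 21 * (real k / 2)\<^sup>2 * l * real n powr (3/2 + real l / real k)"
proof (rule ccontr)
  obtain m where m: "k = 2 * m" using k(1) by blast
  have m0: "m > 0" using k m by simp
  \<comment> \<open>The square of 21 exceeds 432 = 48 * 9, where 48 comes from the closed-walk
    theorem and 9 from the 3 in \<open>\<delta>\<close>.\<close>
  define C where "C = 21 * (real m)\<^sup>2 * l"
  have C: "C > 0" using m0 l by (simp add: C_def)
  let ?\<alpha> = "3/2 + real l / real k"
  assume "\<not> ?thesis"
  moreover have "real k / 2 = m" by (simp add: m)
  ultimately have many: "card E > C * real n powr ?\<alpha>" by (simp only: C_def not_le)
  define A where "A x y \<longleftrightarrow> {x, y} \<in> E" for x y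
  \<comment> \<open>The 3 makes \<open>2 * n * \<delta>\<close> smaller than \<open>card E\<close>,
    as \<open>heavy_subset\<close> demands.\<close>
  define \<delta> where "\<delta> = card E / (3 * n)"
  have npos: "real n powr ?\<alpha> > 0" using n by simp
  have E0: "card E > 0" using many mult_pos_pos[OF C npos] by linarith
  then have \<delta>: "\<delta> > 0" using n by (simp add: \<delta>_def)
  let ?N = "{0..<n}"
  have "card E \<le> card {(x, y) \<in> ?N \<times> ?N. A x y}"
  proof (rule surj_card_le)
    show "E \<subseteq> (\<lambda>(x, y). {x, y}) ` {(x, y) \<in> ?N \<times> ?N. A x y}"
    proof
      fix e assume e: "e \<in> E"
      then have "e \<subseteq> ?N" "card e = 2" using E by (auto simp: simple_graph_def)
      then obtain x y where "e = {x, y}" "x \<in> ?N" "y \<in> ?N" by (auto simp: card_2_iff)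
      then show "e \<in> (\<lambda>(x, y). {x, y}) ` {(x, y) \<in> ?N \<times> ?N. A x y}" using e by (force simp: A_def)
    qed
  qed (rule finite_subset[of _ "?N \<times> ?N"], auto)
  also have "\<dots> = (\<Sum>x\<in>?N. \<Sum>y\<in>?N. of_bool (A x y))"
    unfolding sum.cartesian_product case_prod_unfold by (simp add: sum_of_bool_eq Int_def)
  finally have sumE: "real (card E) \<le> (\<Sum>x\<in>?N. \<Sum>y\<in>?N. of_bool (A x y))"
    by (simp flip: of_nat_le_iff[where 'a = real])
  have heavy: "2 * (\<Sum>x\<in>?N. \<delta>) < (\<Sum>x\<in>?N. \<Sum>y\<in>?N. of_bool (A x y))"
    using sumE n E0 by (simp add: \<delta>_def)
  have A_commute: "of_bool (A x y) = (of_bool (A y x) :: real)" for x y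
    by (simp add: A_def insert_commute)
  obtain U where U: "U \<subseteq> ?N" "U \<noteq> {}" "\<And>x. x \<in> U \<Longrightarrow> \<delta> < (\<Sum>y\<in>U. of_bool (A x y))"
    by (rule heavy_subset[OF finite_atLeastLessThan zero_less_eq_of_bool A_commute heavy]) blast
  interpret min_degree_graph U A \<delta> l
  proof
    show "finite U" using U(1) finite_subset by blast
    show "A y x" if "A x y" for x y using that by (simp add: A_def insert_commute)
  qed (use U \<delta> l in \<open>auto intro: less_imp_le\<close>)
  have "(48 * real m ^ 4 * real l ^ 2 * card U / \<delta>\<^sup>2) ^ m * card U ^ l < 1"
  proof -
    have card_U: "card U \<le> n" using card_mono[OF _ U(1)] by simp
    have "C\<^sup>2 * real n powr (1 + 2 * (real l / real k)) * n\<^sup>2 = (C * real n powr ?\<alpha>)\<^sup>2"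
    proof -
      have "(real n powr ?\<alpha>)\<^sup>2 = real n powr (?\<alpha> + ?\<alpha>)"
        by (simp only: power2_eq_square powr_add)
      also have "?\<alpha> + ?\<alpha> = 1 + 2 * (real l / real k) + 2" by simp
      also have "real n powr \<dots> = real n powr (1 + 2 * (real l / real k)) * n\<^sup>2"
        using n by (subst powr_add) simp
      finally show ?thesis by (simp only: power_mult_distrib mult.assoc of_nat_power)
    qed
    also have "\<dots> < (real (card E))\<^sup>2"
      using many C npos by (intro power_strict_mono) auto
    also have "(real (card E))\<^sup>2 = 9 * \<delta>\<^sup>2 * n\<^sup>2"
      using n by (simp add: \<delta>_def power_divide power_mult_distrib)
    finally have "C\<^sup>2 * real n powr (1 + 2 * (real l / real k)) < 9 * \<delta>\<^sup>2"
      using n by simp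
    then have \<delta>_bound: "C\<^sup>2 * n * real n powr (2 * (real l / real k)) < 9 * \<delta>\<^sup>2"
      using n by (simp add: powr_add mult.assoc)
    \<comment> \<open>Here \<open>l / m\<close> is \<open>2 * l / k\<close>, the surplus in the
      squared edge count; its m-th power will cancel the factor \<open>n ^ l\<close> that bounds the
      number of tuples.\<close>
    have "48 * real m ^ 4 * real l ^ 2 * card U / \<delta>\<^sup>2 < real n powr - (real l / m)"
    proof -
      have "48 * real m ^ 4 * real l ^ 2 * card U * 9 \<le> C\<^sup>2 * n"
      proof -
        have "C\<^sup>2 = 441 * real m ^ 4 * real l ^ 2"
          by (simp add: C_def power_mult_distrib flip: power_mult)
        moreover have "432 * (real m ^ 4 * real l ^ 2 * card U) \<le> 441 * (real m ^ 4 * real l ^ 2 * n)"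
          using card_U by (intro mult_mono) auto
        ultimately show ?thesis by simp
      qed
      then have "48 * real m ^ 4 * real l ^ 2 * card U * 9 * real n powr (real l / m)
          \<le> C\<^sup>2 * n * real n powr (real l / m)"
        by (rule mult_right_mono) simp
      also have "\<dots> < 9 * \<delta>\<^sup>2" using \<delta>_bound by (simp add: m)
      finally have "48 * real m ^ 4 * real l ^ 2 * card U * real n powr (real l / m) < \<delta>\<^sup>2"
        by (simp add: mult_ac)
      then show ?thesis using \<delta> n by (simp add: powr_minus field_simps)
    qed
    then have "(48 * real m ^ 4 * real l ^ 2 * card U / \<delta>\<^sup>2) ^ m < (real n powr - (real l / m)) ^ m"
      using m0 by (intro power_strict_mono) auto
    also have "\<dots> = real n powr - real l"
      using m0 n by (simp add: powr_powr flip: powr_realpow)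
    finally have "(48 * real m ^ 4 * real l ^ 2 * card U / \<delta>\<^sup>2) ^ m * n ^ l < real n powr - real l * n ^ l"
      using n by (intro mult_strict_right_mono) auto
    also have "\<dots> = 1" using n by (simp add: powr_minus powr_realpow)
    finally have "(48 * real m ^ 4 * real l ^ 2 * card U / \<delta>\<^sup>2) ^ m * n ^ l < 1" .
    moreover have "(48 * real m ^ 4 * real l ^ 2 * card U / \<delta>\<^sup>2) ^ m * card U ^ l
        \<le> (48 * real m ^ 4 * real l ^ 2 * card U / \<delta>\<^sup>2) ^ m * n ^ l"
      using card_U by (intro mult_left_mono) (auto intro: power_mono)
    ultimately show ?thesis by linarith
  qed
  from closed_tuple_walk[OF m0 this] obtain w where w: "w ` {..2 * m} \<subseteq> Tup" "w (2 * m) = w 0"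
    "\<And>i. i < 2 * m \<Longrightarrow> tuple_adj l A (w i) (w (Suc i))"
    "\<And>i. i < 2 * m \<Longrightarrow> inj_on (w i) I"
    "\<And>i i' j j'. i < 2 * m \<Longrightarrow> i' < 2 * m \<Longrightarrow> i \<noteq> i' \<Longrightarrow> j \<in> I \<Longrightarrow> j' \<in> I \<Longrightarrow> w i j \<noteq> w i' j'"
    by metis
  have "contains_copy ?N E (torus_V k l) (torus_E k l)"
  proof (rule torus_contained[OF k(1) _ l U(1), of w])
    show "tuple_adj l (\<lambda>x y. {x, y} \<in> E) (w i) (w (Suc i))" if "i < k" for i
      using w(3)[of i] that by (simp add: A_def[abs_def] m)
  qed (use w m k in \<open>auto simp del: PiE_iff\<close>)
  then show False using free by simp
qed

theorem theorem1p5: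
  fixes k l :: nat
  assumes "even k" and "k \<ge> 4" and "l \<ge> 2"
  shows "\<exists>C::real. \<exists>N::nat. \<forall>n\<ge>N.
           real (ex n (torus_V k l) (torus_E k l))
             \<le> C * real n powr (3/2 + real l / real k) * (log 2 (real n))^2"
proof (intro exI allI impI)
  fix n :: nat assume n: "n \<ge> 2"
  let ?\<E> = "{E. simple_graph {0..<n} E \<and> \<not> contains_copy {0..<n} E (torus_V k l) (torus_E k l)}"
  let ?C = "21 * (real k / 2)\<^sup>2 * l"
  have "?\<E> \<subseteq> Pow (Pow {0..<n})" by (auto simp: simple_graph_def)
  then have "finite ?\<E>" by (rule finite_subset) simp
  \<comment> \<open>The torus has an edge, so the empty graph is admissible and the maximum is taken
    over a nonempty set.\<close>
  moreover have "{} \<in> ?\<E>"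
  proof -
    have "{(1, 1), (cyc k 1, 1)} \<in> {{(i, j), (cyc k i, j)} | i j. i \<in> {1..k} \<and> j \<in> {1..l}}"
      by (intro CollectI exI conjI refl) (use assms in auto)
    then have "torus_E k l \<noteq> {}" unfolding torus_E_def by blast
    then show ?thesis by (auto simp: simple_graph_def contains_copy_def)
  qed
  ultimately have "Max (card ` ?\<E>) \<in> card ` ?\<E>" by (intro Max_in) auto
  moreover have "ex n (torus_V k l) (torus_E k l) = Max (card ` ?\<E>)"
    unfolding ex_def by (rule arg_cong[of _ _ Max]) blast
  ultimately obtain E where E: "E \<in> ?\<E>" "ex n (torus_V k l) (torus_E k l) = card E" by auto
  \<comment> \<open>From n = 2 on the logarithm is at least 1, which fixes the threshold for
    n.\<close>
  have log: "1 \<le> (log 2 (real n))\<^sup>2" using n by (simp add: one_le_power)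
  have "real (ex n (torus_V k l) (torus_E k l)) \<le> ?C * real n powr (3/2 + real l / real k)"
    using E torus_free_edge_bound[OF assms, of n E] n by simp
  also have "\<dots> \<le> ?C * real n powr (3/2 + real l / real k) * (log 2 (real n))\<^sup>2"
    using mult_left_mono[OF log, of "?C * real n powr (3/2 + real l / real k)"] by simp
  finally show "real (ex n (torus_V k l) (torus_E k l))
      \<le> ?C * real n powr (3/2 + real l / real k) * (log 2 (real n))\<^sup>2" .
qed

end
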